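(* Let $p\ge 1$, $n\ge 1$, and let the setting, Assumptions A1–A4, the MCP $P_\lambda$, the objectives $\mathcal F_n,\mathcal F_{n,\lambda}$, the S$^3$ONC and the constant $c$ be as described in the context. Set $a:=\frac{1}{2\mathcal U_L}$, $\tilde\Delta:=\ln\!\big(18R(K_C+\mathcal C_\mu)\big)$ and $$\lambda:=\sqrt{\frac{8K(2p+1)^{2/3}}{c\cdot a\cdot n^{2/3}}\Big[\ln(n^{1/3}p)+\tilde\Delta\Big]}.$$ Let $\mathbf X^{\ell_1}\in\arg\min_{\mathbf X\in\mathcal S_p}\ \mathcal F_n(\mathbf X,\mathbf Z_1^n)+\lambda\|\mathbf X\|_*$. Suppose Assumptions A1–A4 hold and let $\mathbf X^{RSAA}\in\mathcal S_p$ with $\sigma_{\max}(\mathbf X^{RSAA})\le R$ satisfy the S$^3$ONC$(\mathbf Z_1^n)$ for problem $\min_{\mathbf X\in\mathcal S_p}\mathcal F_{n,\lambda}(\mathbf X,\mathbf Z_1^n)$ almost surely. Then: (i) There are universal constants $\tilde c, C_1>0$ such that for any $\Gamma\ge 0$: if $$n> C_1\Big[\Big(\tfrac{\Gamma}{K}\Big)^3+1\Big]p+C_1\, s\big(\ln(n^{1/3}p)+\tilde\Delta\big)$$ and $\mathcal F_{n,\lambda}(\mathbf X^{RSAA},\mathbf Z_1^n)\le \mathcal F_{n,\lambda}(\mathbf X^*,\mathbf Z_1^n)+\Gamma$ almost surely, then with probability at least $1-2(p+1)\exp(-\tilde c n)-6\exp\!\big(-2c(2p+1)^{2/3}n^{1/3}\big)$,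 $$\mathbb F(\mathbf X^{RSAA})-\mathbb F(\mathbf X^* )\le \sqrt{\frac{Kp^{1/3}\Gamma}{n^{1/3}}}+\Gamma+C_1K\Big[\frac{s\,p^{2/3}(\ln(n^{1/3}p)+\tilde\Delta)}{n^{2/3}}+\sqrt{\frac{s(\ln(n^{1/3}p)+\tilde\Delta)}{n}}+\frac{p^{1/3}}{n^{1/3}}\Big].$$ (ii) There are universal constants $\tilde c, C_2>0$ such that: if $$n> C_2\cdot p\cdot\mathcal U_L\cdot\big[\ln(n^{1/3}p)+\tilde\Delta\big]\cdot s^{3/2}R^{3/2}$$ and $\mathcal F_{n,\lambda}(\mathbf X^{RSAA},\mathbf Z_1^n)\le \mathcal F_{n,\lambda}(\mathbf X^{\ell_1},\mathbf Z_1^n)$ almost surely, then with probability at least $1-2(p+1)\exp(-\tilde c n)-6\exp\!\big(-2c(2p+1)^{2/3}n^{1/3}\big)$, $$\mathbb F(\mathbf X^{RSAA})-\mathbb F(\mathbf X^* )\le C_2\, s\, K\Big[\frac{p^{2/3}(\ln(n^{1/3}p)+\tilde\Delta)}{n^{2/3}}+\frac{p^{1/3}R\,\mathcal U_L^{1/2}\sqrt{\ln(n^{1/3}p)+\tilde\Delta}}{n^{1/3}}\Big].$$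
   Context: Setting: $\mathcal S_p$ is the cone of $p\times p$ symmetric positive semidefinite matrices. $Z$ is a random vector taking values in $\mathcal W\subseteq\mathbb R^q$; $f:\mathcal S_p\times\mathcal W\to\mathbb R$ is measurable and deterministic, and $\mathbb F(\mathbf X):=\mathbb E[f(\mathbf X,Z)]$ is finite for all $\mathbf X\in\mathcal S_p$. $\mathbf X^*\in\arg\min\{\mathbb F(\mathbf X):\mathbf X\in\mathcal S_p\}$ with $\sigma_{\max}(\mathbf X^* )\le R$ for a constant $R\ge 1$ ($\sigma_{\max}$ = spectral norm). $\mathbf Z_1^n=(Z_1,\dots,Z_n)$ are i.i.d. copies of $Z$, $\mathcal F_n(\mathbf X,\mathbf Z_1^n):=\frac1n\sum_{i=1}^n f(\mathbf X,Z_i)$. For $a,\lambda>0$, the minimax concave penalty is $P_\lambda(x)=\int_0^x\frac{[a\lambda-t]_+}{a}\,dt$, and $\mathcal F_{n,\lambda}(\mathbf X,\mathbf Z_1^n):=\mathcal F_n(\mathbf X,\mathbf Z_1^n)+\sum_{j=1}^pP_\lambda(\sigma_j(\mathbf X))$, where $\sigma_j(\mathbf X)$ is the $j$-th eigenvalue (singular value) of $\mathbf X$. $\|\cdot\|_*$ is the nuclear norm, ${\bf rk}$ the rank, $\|\cdot\|$ the Frobenius (2-)norm of a matrix, $\|\cdot\|_{\psi_1}$ the sub-exponential norm. Assumptions: (A1) $s:={\bf rk}(\mathbf X^* )$ satisfies $1\le s\ll p$. (A2) For some $\mathcal U_L\ge1$, $\big|\frac{\partial f(\mathbf X,z)}{\partial\sigma_j(\mathbf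 X)}|_{\mathbf X=\mathbf X_1}-\frac{\partial f(\mathbf X,z)}{\partial\sigma_j(\mathbf X)}|_{\mathbf X=\mathbf X_2}\big|<\mathcal U_L|\sigma_j(\mathbf X_1)-\sigma_j(\mathbf X_2)|$ for all $j$, all $\mathbf X_1,\mathbf X_2\in\mathcal S_p$, a.e. $z\in\mathcal W$. (A3) The random variables $f(\mathbf X,Z_i)-\mathbb E[f(\mathbf X,Z_i)]$, $i=1,\dots,n$, are independent and sub-exponential with $\|f(\mathbf X,Z_i)-\mathbb E f(\mathbf X,Z_i)\|_{\psi_1}\le K$ for some $K\ge1$, for all $\mathbf X\in\mathcal S_p$ with $\sigma_{\max}(\mathbf X)\le R$. (A4) There is a measurable deterministic $\mathcal C:\mathcal W\to\mathbb R$ with $\mathbb E|\mathcal C(Z)|\le\mathcal C_\mu$ for some $\mathcal C_\mu\ge1$, $\|\mathcal C(Z)-\mathbb E\mathcal C(Z)\|_{\psi_1}\le K_C$ for some $K_C\ge1$, and $|f(\mathbf X_1,z)-f(\mathbf X_2,z)|\le\mathcal C(z)\|\mathbf X_1-\mathbf X_2\|$ for all $\mathbf X_1,\mathbf X_2\in\mathcal S_p$ and a.e. $z$. $c\in(0,1/2]$ is the absolute constant of the Bernstein inequality: $\mathbb P\big(|\sum_i a_i\{f(\mathbf X,Z_i)-\mathbb E f(\mathbf X,Z_i)\}|>K(\|\mathbf a\|\sqrt t+\|\mathbf a\|_\infty t)\big)\le 2e^{-ct}$ for all $t\ge0$, $\mathbf a\in\mathbb R^n$. S$^3$ONC: $\hat{\mathbf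 X}\in\mathcal S_p$ satisfies S$^3$ONC$(\mathbf Z_1^n)$ for $\min_{\mathbf X\in\mathcal S_p}\mathcal F_{n,\lambda}$ if (a) $\nabla\mathcal F_{n,\lambda}(\hat{\mathbf X},\mathbf Z_1^n)=0$, and (b) for every $j$ with $\sigma_j(\hat{\mathbf X})\in(0,a\lambda)$, $\mathcal U_L+\frac{\partial^2P_\lambda(\sigma_j(\mathbf X))}{[\partial\sigma_j(\mathbf X)]^2}\big|_{\mathbf X=\hat{\mathbf X}}\ge0$. *)

theory Defs
  imports "HOL-Probability.Probability" "Jordan_Normal_Form.DL_Rank" "Jordan_Normal_Form.Char_Poly"
begin

text \<open>Matrices are JNF matrices of type real mat; a sample point z lives in nat => real
 (a vector of R^q, i.e. with z i = 0 for i >= q).\<close>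

definition Sp :: "nat \<Rightarrow> real mat set" where
  "Sp p = {X \<in> carrier_mat p p. transpose_mat X = X \<and>
            (\<forall>v \<in> carrier_vec p. scalar_prod v (X *\<^sub>v v) \<ge> 0)}"

text \<open>Eigenvalues (with multiplicity) in non-increasing order; sigma X j is the (j+1)-th one
 (indices j = 0..p-1 correspond to the paper's j = 1..p).\<close>
definition eigs :: "real mat \<Rightarrow> real list" where
  "eigs X = rev (sorted_list_of_multiset (proots (char_poly X)))"

definition sigma :: "real mat \<Rightarrow> nat \<Rightarrow> real" where
  "sigma X j = eigs X ! j"

definition sigma_max :: "real mat \<Rightarrow> real" where
  "sigma_max X = Sup {sqrt (scalar_prod (X *\<^sub>v v) (X *\<^sub>v v)) | v.
                        v \<in> carrier_vec (dim_col X) \<and> scalar_prod v v \<le> 1}"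

definition nuc_norm :: "real mat \<Rightarrow> real" where
  "nuc_norm X = sum_mset (image_mset sqrt (proots (char_poly (transpose_mat X * X))))"

definition frob :: "real mat \<Rightarrow> real" where
  "frob X = sqrt (\<Sum>i<dim_row X. \<Sum>j<dim_col X. (X $$ (i,j))\<^sup>2)"

definition mat_rank :: "nat \<Rightarrow> real mat \<Rightarrow> nat" where
  "mat_rank p X = vec_space.rank p (X :: real mat)"

definition MCP :: "real \<Rightarrow> real \<Rightarrow> real \<Rightarrow> real" where
  "MCP a lam x = integral {0..x} (\<lambda>t. max (a * lam - t) 0 / a)"

definition Fn :: "(real mat \<Rightarrow> (nat \<Rightarrow> real) \<Rightarrow> real) \<Rightarrow> nat \<Rightarrow> real mat \<Rightarrow> (nat \<Rightarrow> nat \<Rightarrow> real) \<Rightarrow> real" where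
  "Fn f n X zs = (\<Sum>i<n. f X (zs i)) / real n"

definition Fnl :: "(real mat \<Rightarrow> (nat \<Rightarrow> real) \<Rightarrow> real) \<Rightarrow> nat \<Rightarrow> real \<Rightarrow> real \<Rightarrow> real mat \<Rightarrow> (nat \<Rightarrow> nat \<Rightarrow> real) \<Rightarrow> real" where
  "Fnl f n a lam X zs = Fn f n X zs + (\<Sum>j<dim_row X. MCP a lam (sigma X j))"

definition EF :: "(nat \<Rightarrow> real) measure \<Rightarrow> (real mat \<Rightarrow> (nat \<Rightarrow> real) \<Rightarrow> real) \<Rightarrow> real mat \<Rightarrow> real" where
  "EF \<mu> f X = (\<integral>z. f X z \<partial>\<mu>)"

definition sampleM :: "nat \<Rightarrow> (nat \<Rightarrow> real) measure \<Rightarrow> (nat \<Rightarrow> nat \<Rightarrow> real) measure" where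
  "sampleM n \<mu> = PiM {..<n} (\<lambda>_. \<mu>)"

text \<open>Sub-exponential (psi_1) norm, infinite if the variable is not sub-exponential.\<close>
definition psi1 :: "'a measure \<Rightarrow> ('a \<Rightarrow> real) \<Rightarrow> ennreal" where
  "psi1 M Y = Inf {ennreal t | t. t > 0 \<and> (\<integral>\<^sup>+ x. ennreal (exp (\<bar>Y x\<bar> / t)) \<partial>M) \<le> 2}"

definition zero_grad_within :: "real mat set \<Rightarrow> (real mat \<Rightarrow> real) \<Rightarrow> real mat \<Rightarrow> bool" where
  "zero_grad_within S F x \<longleftrightarrow>
     (\<forall>\<epsilon>>0. \<exists>\<delta>>0. \<forall>X\<in>S. frob (X - x) < \<delta> \<longrightarrow> \<bar>F X - F x\<bar> \<le> \<epsilon> * frob (X - x))"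

definition S3ONC :: "nat \<Rightarrow> (real mat \<Rightarrow> (nat \<Rightarrow> real) \<Rightarrow> real) \<Rightarrow> nat \<Rightarrow> real \<Rightarrow> real \<Rightarrow> real
                     \<Rightarrow> (nat \<Rightarrow> nat \<Rightarrow> real) \<Rightarrow> real mat \<Rightarrow> bool" where
  "S3ONC p f n a lam UL zs Xh \<longleftrightarrow> Xh \<in> Sp p \<and>
     zero_grad_within (Sp p) (\<lambda>X. Fnl f n a lam X zs) Xh \<and>
     (\<forall>j<p. 0 < sigma Xh j \<and> sigma Xh j < a * lam \<longrightarrow>
            UL + deriv (deriv (MCP a lam)) (sigma Xh j) \<ge> 0)"

definition eig_dec :: "nat \<Rightarrow> real mat \<Rightarrow> real mat \<Rightarrow> bool" where
  "eig_dec p X U \<longleftrightarrow> U \<in> carrier_mat p p \<and> transpose_mat U * U = one_mat p \<and>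
      X = U * mat_diag p (sigma X) * transpose_mat U"

definition sigma_path :: "nat \<Rightarrow> (real mat \<Rightarrow> (nat \<Rightarrow> real) \<Rightarrow> real) \<Rightarrow> real mat \<Rightarrow> real mat
                          \<Rightarrow> nat \<Rightarrow> (nat \<Rightarrow> real) \<Rightarrow> real \<Rightarrow> real" where
  "sigma_path p f X U j z t = f (U * mat_diag p ((sigma X)(j := t)) * transpose_mat U) z"

definition matM :: "nat \<Rightarrow> real mat measure" where
  "matM p = vimage_algebra (Sp p) (\<lambda>X ij. if fst ij < p \<and> snd ij < p then X $$ ij else 0)
             (borel :: (nat \<times> nat \<Rightarrow> real) measure)"

definition setting :: "nat \<Rightarrow> nat \<Rightarrow> (nat \<Rightarrow> real) measure \<Rightarrow> (real mat \<Rightarrow> (nat \<Rightarrow> real) \<Rightarrow> real) \<Rightarrow> bool" where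
  "setting p q \<mu> f \<longleftrightarrow> prob_space \<mu> \<and> sets \<mu> = sets borel \<and>
     (AE z in \<mu>. \<forall>i\<ge>q. z i = 0) \<and>
     (\<lambda>(X, z). f X z) \<in> borel_measurable (matM p \<Otimes>\<^sub>M \<mu>) \<and>
     (\<forall>X\<in>Sp p. integrable \<mu> (f X))"

definition A2 :: "nat \<Rightarrow> (nat \<Rightarrow> real) measure \<Rightarrow> (real mat \<Rightarrow> (nat \<Rightarrow> real) \<Rightarrow> real) \<Rightarrow> real \<Rightarrow> bool" where
  "A2 p \<mu> f UL \<longleftrightarrow>
     (\<forall>j<p. \<forall>X1\<in>Sp p. \<forall>X2\<in>Sp p. \<forall>U1 U2. eig_dec p X1 U1 \<and> eig_dec p X2 U2 \<longrightarrow>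
        (AE z in \<mu>. \<exists>d1 d2.
           (sigma_path p f X1 U1 j z has_real_derivative d1) (at (sigma X1 j) within {0..}) \<and>
           (sigma_path p f X2 U2 j z has_real_derivative d2) (at (sigma X2 j) within {0..}) \<and>
           \<bar>d1 - d2\<bar> \<le> UL * \<bar>sigma X1 j - sigma X2 j\<bar>))"

definition A3 :: "nat \<Rightarrow> (nat \<Rightarrow> real) measure \<Rightarrow> (real mat \<Rightarrow> (nat \<Rightarrow> real) \<Rightarrow> real) \<Rightarrow> real \<Rightarrow> real \<Rightarrow> bool" where
  "A3 p \<mu> f R K \<longleftrightarrow>
     (\<forall>X\<in>Sp p. sigma_max X \<le> R \<longrightarrow> psi1 \<mu> (\<lambda>z. f X z - EF \<mu> f X) \<le> ennreal K)"

definition A4 :: "nat \<Rightarrow> (nat \<Rightarrow> real) measure \<Rightarrow> (real mat \<Rightarrow> (nat \<Rightarrow> real) \<Rightarrow> real)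
                  \<Rightarrow> ((nat \<Rightarrow> real) \<Rightarrow> real) \<Rightarrow> real \<Rightarrow> real \<Rightarrow> bool" where
  "A4 p \<mu> f C Cmu KC \<longleftrightarrow> C \<in> borel_measurable \<mu> \<and>
     (\<integral>\<^sup>+ z. ennreal \<bar>C z\<bar> \<partial>\<mu>) \<le> ennreal Cmu \<and>
     psi1 \<mu> (\<lambda>z. C z - (\<integral>z. C z \<partial>\<mu>)) \<le> ennreal KC \<and>
     (\<forall>X1\<in>Sp p. \<forall>X2\<in>Sp p. AE z in \<mu>. \<bar>f X1 z - f X2 z\<bar> \<le> C z * frob (X1 - X2))"

definition bernstein :: "nat \<Rightarrow> nat \<Rightarrow> (nat \<Rightarrow> real) measure \<Rightarrow> (real mat \<Rightarrow> (nat \<Rightarrow> real) \<Rightarrow> real)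
                         \<Rightarrow> real \<Rightarrow> real \<Rightarrow> real \<Rightarrow> bool" where
  "bernstein p n \<mu> f R K c \<longleftrightarrow>
     (\<forall>X\<in>Sp p. sigma_max X \<le> R \<longrightarrow> (\<forall>t\<ge>0. \<forall>a :: nat \<Rightarrow> real.
        measure (sampleM n \<mu>) {zs \<in> space (sampleM n \<mu>).
            \<bar>\<Sum>i<n. a i * (f X (zs i) - EF \<mu> f X)\<bar>
              > K * (sqrt (\<Sum>i<n. (a i)\<^sup>2) * sqrt t + Max ((\<lambda>i. \<bar>a i\<bar>) ` {..<n}) * t)}
        \<le> 2 * exp (- c * t)))"

end

theory Submission
  imports Defs
begin

text \<open>
  Since a = 1/(2 UL), the second-order part of the S3ONC forces every nonzero eigenvalue of the
  estimator to be at least a lam, so a solution of rank k pays exactly k a lam^2 / 2. Put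
  y = ((2p+1)/n)^(1/3); then this penalty is 4 K x_k with x_k = k L y^2 / c. Writing a positive
  semidefinite matrix of rank k as B B^T with B of size p times k and discretising the entries of B,
  Bernstein's inequality and a union bound give, with high probability and for all k
  at once, a deviation of at most K (sqrt (x_k y) + ...) \<le> K (3/2 x_k + 5 y) by AM-GM. The penalty
  absorbs the x_k term, and what remains is the suboptimality of the estimator at the true minimiser
  plus a multiple of K y. For the nuclear-norm start the suboptimality is bounded through
  P_lam(x) \<le> lam x by lam s R.
\<close>

section \<open>The minimax concave penalty\<close>

text \<open>The estimator is data-dependent and its map is not assumed measurable, while A4 controls
  the empirical risk only almost surely for each fixed pair of matrices. Two devices meet this. All
  randomness is confined to a measurable event \<open>A\<close> built from countably many fixed
  matrices, on which the bound holds for every matrix where the empirical risk is continuous; and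
  the first-order part of the S3ONC supplies that continuity, because the spectral penalty is
  Lipschitz. The numbers fit as follows. The net for rank k has at most e^(2Lpk) points, and the
  Bernstein exponent c \<open>t k\<close> = k(2p+1)L + 2 c n y^2 leaves a surplus kL that makes the
  sum over k converge; the rest is the exponent of the stated probability. The deviation costs 3/2 K
  x_k against a penalty of 4 K x_k. The lower bounds on n enter through 2p+1 \<le> n, that is y
  \<le> 1, which lets the linear Bernstein term be bounded like the root term.\<close>

definition mcp_form :: "real \<Rightarrow> real \<Rightarrow> real \<Rightarrow> real" where
  "mcp_form a lam x = a * lam\<^sup>2 / 2 - (max (a * lam - x) 0)\<^sup>2 / (2 * a)"

lemma MCP_eq:
  assumes a: "a > 0" and lam: "lam \<ge> 0" and x: "x \<ge> 0"
  shows "MCP a lam x = mcp_form a lam x"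
proof -
  have low: "((\<lambda>t. max (a * lam - t) 0 / a) has_integral (lam * y - y\<^sup>2 / (2 * a))) {0..y}"
    if y: "0 \<le> y" "y \<le> a * lam" for y
  proof -
    have "((\<lambda>t. (a * lam - t) / a) has_integral (lam * y - y\<^sup>2 / (2 * a)) - (lam * 0 - 0\<^sup>2 / (2 * a))) {0..y}"
      by (rule fundamental_theorem_of_calculus)
         (use a y in \<open>auto intro!: derivative_eq_intros simp: field_simps simp flip: has_real_derivative_iff_has_vector_derivative\<close>)
    then show ?thesis
      by (subst has_integral_cong[where g = "\<lambda>t. (a * lam - t) / a"]) (use y in \<open>auto\<close>)
  qed
  show ?thesis
  proof (cases "x \<le> a * lam")
    case True
    have "MCP a lam x = lam * x - x\<^sup>2 / (2 * a)"
      unfolding MCP_def by (rule integral_unique, rule low) (use True x in auto)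
    also have "\<dots> = mcp_form a lam x"
      using True a by (simp add: mcp_form_def field_simps power2_eq_square)
    finally show ?thesis .
  next
    case False
    have "((\<lambda>t. max (a * lam - t) 0 / a) has_integral 0) {a * lam..x}"
      by (subst has_integral_cong[where g = "\<lambda>t. 0"]) auto
    then have "((\<lambda>t. max (a * lam - t) 0 / a) has_integral
        (lam * (a * lam) - (a * lam)\<^sup>2 / (2 * a)) + 0) {0..x}"
      using low[of "a * lam"] False a lam by (intro has_integral_combine[of 0 "a * lam" x]) auto
    then have "MCP a lam x = (lam * (a * lam) - (a * lam)\<^sup>2 / (2 * a)) + 0"
      unfolding MCP_def by (rule integral_unique)
    also have "\<dots> = mcp_form a lam x"
      using False a by (simp add: mcp_form_def field_simps power2_eq_square)
    finally show ?thesis .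
  qed
qed

text \<open>Concavity in tangent form. The closed formula is concave on the whole line and covers
  the quadratic range and the plateau at once, so neither \<open>y\<close> nor \<open>g\<close>
  needs a sign condition.\<close>

lemma mcp_form_tangent:
  assumes "a > 0"
  shows "mcp_form a lam y \<le> mcp_form a lam g + max (a * lam - g) 0 / a * (y - g)"
proof -
  let ?m = "\<lambda>x. max (a * lam - x) 0"
  have "0 \<le> (?m y - ?m g)\<^sup>2" by simp
  then have "(?m y)\<^sup>2 - (?m g)\<^sup>2 \<ge> 2 * ?m g * (?m y - ?m g)"
    by (simp add: power2_eq_square algebra_simps)
  \<comment> \<open>If m(g) > 0 then m(g) = a lam - g, while m(y) \<ge> a lam - y always; if m(g) =
    0 both sides vanish.\<close>
  moreover have "?m g * (?m y - ?m g) \<ge> ?m g * (g - y)"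
  proof (cases "a * lam - g > 0")
    case True
    then show ?thesis by (intro mult_left_mono) auto
  qed auto
  ultimately have "(?m y)\<^sup>2 - (?m g)\<^sup>2 \<ge> 2 * ?m g * (g - y)" by linarith
  then have "((?m y)\<^sup>2 - (?m g)\<^sup>2) / (2 * a) \<ge> (2 * ?m g * (g - y)) / (2 * a)"
    using assms by (intro divide_right_mono) auto
  moreover have "(2 * ?m g * (g - y)) / (2 * a) = - (?m g / a * (y - g))"
    using assms by (simp add: field_simps)
  ultimately show ?thesis unfolding mcp_form_def by (simp add: diff_divide_distrib)
qed

lemma mcp_slope:
  fixes a lam g :: real
  assumes "a > 0" "lam \<ge> 0" "g \<ge> 0"
  shows "0 \<le> max (a * lam - g) 0 / a" "max (a * lam - g) 0 / a \<le> lam"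
proof -
  show "0 \<le> max (a * lam - g) 0 / a" using assms by (intro divide_nonneg_pos) auto
  have "max (a * lam - g) 0 \<le> lam * a" using assms by (simp add: mult.commute)
  then show "max (a * lam - g) 0 / a \<le> lam" using assms by (simp add: pos_divide_le_eq)
qed

lemma mcp_form_le_linear:
  assumes "a > 0" "lam \<ge> 0"
  shows "mcp_form a lam x \<le> lam * x"
  using mcp_form_tangent[OF assms(1), of lam x 0] assms
  by (simp add: mcp_form_def power2_eq_square)

text \<open>Take the tangent at \<open>g\<close>: for g \<ge> 0 its slope lies between 0 and lam,
  and nothing is asked of \<open>y\<close>.\<close>

lemma mcp_form_diff_le:
  assumes "a > 0" "lam \<ge> 0" "g \<ge> 0"
  shows "mcp_form a lam y - mcp_form a lam g \<le> lam * \<bar>y - g\<bar>"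
proof -
  have "max (a * lam - g) 0 / a * (y - g) \<le> max (a * lam - g) 0 / a * \<bar>y - g\<bar>"
    using mcp_slope(1)[OF assms] by (intro mult_left_mono) auto
  also have "\<dots> \<le> lam * \<bar>y - g\<bar>"
    using mcp_slope(2)[OF assms] by (intro mult_right_mono) auto
  finally show ?thesis using mcp_form_tangent[OF assms(1), of lam y g] by linarith
qed

lemma mcp_form_0 [simp]: "a > 0 \<Longrightarrow> lam \<ge> 0 \<Longrightarrow> mcp_form a lam 0 = 0"
  by (simp add: mcp_form_def power2_eq_square)

lemma mcp_form_le: "a > 0 \<Longrightarrow> mcp_form a lam x \<le> a * lam\<^sup>2 / 2"
  by (simp add: mcp_form_def)

lemma mcp_form_saturated: "x \<ge> a * lam \<Longrightarrow> mcp_form a lam x = a * lam\<^sup>2 / 2"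
  by (simp add: mcp_form_def)

lemma deriv2_MCP:
  assumes a: "a > 0" and x: "0 < x" "x < a * lam"
  shows "deriv (deriv (MCP a lam)) x = - 1 / a"
proof -
  have lam: "lam \<ge> 0" using a x by (meson less_trans less_imp_le zero_less_mult_pos)
  have d1: "deriv (MCP a lam) y = lam - y / a" if "y \<in> {0<..<a * lam}" for y
  proof (rule DERIV_imp_deriv)
    \<comment> \<open>The quadratic formula holds only between 0 and a lam, so both derivatives are
      computed from equality on a neighbourhood rather than from a global identity.\<close>
    have ev: "\<forall>\<^sub>F t in nhds y. t \<in> {0<..<a * lam}"
      using that by (intro eventually_nhds_in_open) auto
    have "\<forall>\<^sub>F t in nhds y. MCP a lam t = lam * t - t\<^sup>2 / (2 * a)"
      using ev
    proof eventually_elim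
      case (elim t)
      then show ?case
        using MCP_eq[OF a lam, of t] a by (simp add: mcp_form_def field_simps power2_eq_square)
    qed
    moreover have "((\<lambda>t. lam * t - t\<^sup>2 / (2 * a)) has_real_derivative lam - y / a) (at y)"
      using a by (auto intro!: derivative_eq_intros simp: field_simps)
    ultimately show "(MCP a lam has_real_derivative lam - y / a) (at y)"
      by (subst DERIV_cong_ev[OF refl _ refl]) auto
  qed
  show ?thesis
  proof (rule DERIV_imp_deriv)
    have "\<forall>\<^sub>F t in nhds x. t \<in> {0<..<a * lam}"
      using x by (intro eventually_nhds_in_open) auto
    then have "\<forall>\<^sub>F t in nhds x. deriv (MCP a lam) t = lam - t / a"
      by eventually_elim (rule d1)
    moreover have "((\<lambda>t. lam - t / a) has_real_derivative - 1 / a) (at x)"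
      using a by (auto intro!: derivative_eq_intros simp: field_simps)
    ultimately show "(deriv (MCP a lam) has_real_derivative - 1 / a) (at x)"
      by (subst DERIV_cong_ev[OF refl _ refl]) auto
  qed
qed

section \<open>The spectral theorem for real symmetric matrices\<close>

text \<open>Tychonoff for the function topology; applied twice, it makes a box of doubly indexed
  arrays compact.\<close>

lemma compact_PiE_UNIV:
  fixes S :: "'i \<Rightarrow> 'a::topological_space set"
  assumes "\<And>i. compact (S i)"
  shows "compact (PiE UNIV S)"
proof -
  have "compactin (product_topology (\<lambda>i. euclidean) UNIV) (PiE UNIV S)"
    using assms by (simp add: compactin_PiE)
  then show ?thesis by (simp add: euclidean_product_topology)
qed

definition ortho :: "nat \<Rightarrow> (nat \<Rightarrow> nat \<Rightarrow> real) \<Rightarrow> bool" where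
  "ortho p q \<longleftrightarrow> (\<forall>j<p. \<forall>k<p. (\<Sum>i<p. q i j * q i k) = (if j = k then 1 else 0))"

definition quad :: "nat \<Rightarrow> (nat \<Rightarrow> nat \<Rightarrow> real) \<Rightarrow> (nat \<Rightarrow> real) \<Rightarrow> (nat \<Rightarrow> real) \<Rightarrow> real" where
  "quad p A v w = (\<Sum>i<p. \<Sum>l<p. v i * A i l * w l)"

lemma quad_combination:
  "quad p A (\<lambda>i. a * v i + b * w i) (\<lambda>i. c * x i + d * y i)
   = a * c * quad p A v x + a * d * quad p A v y + b * c * quad p A w x + b * d * quad p A w y"
  unfolding quad_def sum_distrib_left sum.distrib[symmetric]
  by (intro sum.cong refl) (simp add: algebra_simps)

lemma quad_sym:
  assumes "\<And>i l. i < p \<Longrightarrow> l < p \<Longrightarrow> A i l = A l i"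
  shows "quad p A v w = quad p A w v"
  unfolding quad_def by (subst sum.swap) (auto intro!: sum.cong simp: assms)

lemma ortho_entry_le:
  assumes "ortho p q" "i < p" "j < p"
  shows "\<bar>q i j\<bar> \<le> 1"
proof -
  have "(q i j)\<^sup>2 \<le> (\<Sum>i<p. (q i j)\<^sup>2)"
    using assms by (intro member_le_sum) auto
  also have "\<dots> = 1" using assms by (simp add: ortho_def power2_eq_square)
  finally show ?thesis by (simp add: abs_square_le_1)
qed

lemma continuous_on_entry: "continuous_on S (\<lambda>q::nat \<Rightarrow> nat \<Rightarrow> real. q i j)"
  by (rule continuous_on_subset[OF continuous_on_product_then_coordinatewise
        [OF continuous_on_product_coordinates[of i]] subset_UNIV])

text \<open>\<open>ortho\<close> leaves the entries outside the p by p block free. They are pinned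
  to 0, since otherwise the set would be unbounded; inside the block unit columns keep every entry
  in [-1, 1].\<close>

lemma compact_ortho:
  "compact {q. ortho p q \<and> (\<forall>i j. \<not> (i < p \<and> j < p) \<longrightarrow> q i j = 0)}" (is "compact ?S")
proof -
  let ?B = "PiE UNIV (\<lambda>i::nat. PiE UNIV (\<lambda>j::nat. {-1..1::real}))"
  have B: "compact ?B"
    by (intro compact_PiE_UNIV) auto
  have cl: "closed ?S"
  proof -
    have "?S = (\<Inter>j\<in>{..<p}. \<Inter>k\<in>{..<p}. {q. (\<Sum>i<p. q i j * q i k) = (if j = k then 1 else 0)})
        \<inter> (\<Inter>ij\<in>{ij. \<not> (fst ij < p \<and> snd ij < p)}. {q. q (fst ij) (snd ij) = 0})"
      by (auto simp: ortho_def)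
    moreover have "closed \<dots>"
      by (intro closed_Int closed_INT ballI closed_Collect_eq continuous_on_sum continuous_on_mult
          continuous_on_const continuous_on_entry)
    ultimately show ?thesis by simp
  qed
  have "?S \<subseteq> ?B"
  proof (rule subsetI, unfold PiE_UNIV_domain Pi_iff, intro ballI)
    fix q i j assume "q \<in> ?S"
    then show "q i j \<in> {-1..1}"
      using ortho_entry_le[of p q i j] by (cases "i < p \<and> j < p") (auto simp: abs_le_iff)
  qed
  then have "?S = ?B \<inter> ?S" by blast
  then show ?thesis
    using compact_Int_closed[OF B cl] by presburger
qed

lemma ortho_rotate:
  assumes q: "ortho p q" and rs: "r < p" "s < p" "r \<noteq> s" and cs: "c\<^sup>2 + t\<^sup>2 = (1::real)"
  defines "q' \<equiv> \<lambda>i j. if j = r then c * q i r + t * q i s else if j = s then - t * q i r + c * q i s else q i j"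
  shows "ortho p q'"
proof -
  let ?I = "\<lambda>j k. \<Sum>i<p. q i j * q i k"
  have I: "?I j k = (if j = k then 1 else 0)" if "j < p" "k < p" for j k
    using q that by (auto simp: ortho_def)
  \<comment> \<open>Inner products of the new columns are bilinear in the old ones:
    \<open>two\<close> treats pairs among the rotated columns, \<open>one\<close> and
    \<open>one'\<close> pairs with a single rotated column.\<close>
  have two: "(\<Sum>i<p. (a * q i r + b * q i s) * (c * q i r + d * q i s)) = a * c + b * d" for a b c d
  proof -
    have "(\<Sum>i<p. (a * q i r + b * q i s) * (c * q i r + d * q i s))
        = a * c * ?I r r + a * d * ?I r s + b * c * ?I s r + b * d * ?I s s"
      unfolding sum_distrib_left sum.distrib[symmetric]
      by (intro sum.cong refl) (simp add: algebra_simps)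
    then show ?thesis using rs by (simp add: I)
  qed
  have one: "(\<Sum>i<p. (a * q i r + b * q i s) * q i k) = 0" if "k < p" "k \<noteq> r" "k \<noteq> s" for a b k
  proof -
    have "(\<Sum>i<p. (a * q i r + b * q i s) * q i k) = a * ?I r k + b * ?I s k"
      unfolding sum_distrib_left sum.distrib[symmetric]
      by (intro sum.cong refl) (simp add: algebra_simps)
    then show ?thesis using rs that by (simp add: I)
  qed
  have one': "(\<Sum>i<p. q i k * (a * q i r + b * q i s)) = 0" if "k < p" "k \<noteq> r" "k \<noteq> s" for a b k
    using one[OF that, of a b] by (simp add: mult.commute)
  have cs': "c * c + t * t = 1" "t * t + c * c = 1" using cs by (simp_all add: power2_eq_square)
  show ?thesis unfolding ortho_def
  proof (intro allI impI)
    fix j k assume jk: "j < p" "k < p"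
    show "(\<Sum>i<p. q' i j * q' i k) = (if j = k then 1 else 0)"
      unfolding q'_def using rs jk cs'
      by (cases "j = r"; cases "j = s"; cases "k = r"; cases "k = s")
         (simp_all only: if_True if_False refl simp_thms two one one' I, auto simp: algebra_simps)
  qed
qed

text \<open>Maximise the sum over j of j (Q^T A Q)_jj over the compact orthogonal group: as the weights are
  distinct, stationarity under plane rotations makes the off-diagonal entries vanish.\<close>
lemma ortho_diagonalises:
  fixes A :: "nat \<Rightarrow> nat \<Rightarrow> real"
  assumes sym: "\<And>i l. i < p \<Longrightarrow> l < p \<Longrightarrow> A i l = A l i"
  shows "\<exists>q. ortho p q \<and> (\<forall>r<p. \<forall>s<p. r \<noteq> s \<longrightarrow> quad p A (\<lambda>i. q i r) (\<lambda>i. q i s) = 0)"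
proof -
  let ?S = "{q. ortho p q \<and> (\<forall>i j. \<not> (i < p \<and> j < p) \<longrightarrow> q i j = 0)}"
  let ?F = "\<lambda>q. \<Sum>j<p. real j * quad p A (\<lambda>i. q i j) (\<lambda>i. q i j)"
  have "continuous_on ?S ?F"
    unfolding quad_def by (intro continuous_intros continuous_on_entry)
  moreover have "(\<lambda>i j. if i < p \<and> j < p \<and> i = j then 1 else 0) \<in> ?S"
  proof -
    have "(\<Sum>i<p. (if i < p \<and> j < p \<and> i = j then 1 else 0) * (if i < p \<and> k < p \<and> i = k then 1 else 0))
        = (if j = k then 1 else (0::real))" if "j < p" "k < p" for j k
    proof -
      have "(\<Sum>i<p. (if i < p \<and> j < p \<and> i = j then 1 else 0) * (if i < p \<and> k < p \<and> i = k then 1 else 0))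
          = (\<Sum>i<p. if i = j then (if j = k then 1 else (0::real)) else 0)"
        using that by (intro sum.cong) auto
      then show ?thesis using that by simp
    qed
    then show ?thesis by (auto simp: ortho_def)
  qed
  ultimately obtain q where q: "q \<in> ?S" and max: "\<And>q'. q' \<in> ?S \<Longrightarrow> ?F q' \<le> ?F q"
    using continuous_attains_sup[OF compact_ortho[of p], of ?F] by blast
  have "quad p A (\<lambda>i. q i r) (\<lambda>i. q i s) = 0" if rs: "r < p" "s < p" "r \<noteq> s" for r s
  proof -
    let ?T = "\<lambda>j k. quad p A (\<lambda>i. q i j) (\<lambda>i. q i k)"
    \<comment> \<open>The gain of the weighted sum when columns r and s are rotated by the angle
      \<theta>. Maximality gives g \<le> 0 = g(0), so the derivative 2 (r - s) T_rs at 0 vanishes,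
      and r \<noteq> s.\<close>
    define g where "g \<theta> = (real r - real s) * ((sin \<theta>)\<^sup>2 * (?T s s - ?T r r) + 2 * sin \<theta> * cos \<theta> * ?T r s)" for \<theta>
    have "g \<theta> \<le> 0" for \<theta>
    proof -
      define c t where "c = cos \<theta>" and "t = sin \<theta>"
      have ct: "c\<^sup>2 + t\<^sup>2 = 1" by (simp add: c_def t_def)
      define q' where "q' = (\<lambda>i j. if j = r then c * q i r + t * q i s else if j = s then - t * q i r + c * q i s else q i j)"
      have "q' \<in> ?S" using q ortho_rotate[OF _ rs ct, of q] rs by (auto simp: q'_def)
      then have le: "?F q' \<le> ?F q" by (rule max)
      have split: "sum h {..<p} = h r + (h s + sum h ({..<p} - {r} - {s}))" for h :: "nat \<Rightarrow> real"
        using rs by (simp add: sum.remove[of "{..<p}" r] sum.remove[of "{..<p} - {r}" s])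
      have "sum (\<lambda>j. real j * quad p A (\<lambda>i. q' i j) (\<lambda>i. q' i j)) ({..<p} - {r} - {s})
          = sum (\<lambda>j. real j * quad p A (\<lambda>i. q i j) (\<lambda>i. q i j)) ({..<p} - {r} - {s})"
        by (intro sum.cong) (auto simp: q'_def)
      with le have "real r * quad p A (\<lambda>i. q' i r) (\<lambda>i. q' i r) + real s * quad p A (\<lambda>i. q' i s) (\<lambda>i. q' i s)
          \<le> real r * ?T r r + real s * ?T s s"
        unfolding split by linarith
      moreover have "quad p A (\<lambda>i. q' i r) (\<lambda>i. q' i r) = c\<^sup>2 * ?T r r + 2 * c * t * ?T r s + t\<^sup>2 * ?T s s"
        using quad_combination[of p A c "\<lambda>i. q i r" t "\<lambda>i. q i s" c "\<lambda>i. q i r" t "\<lambda>i. q i s"]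
          quad_sym[of p A "\<lambda>i. q i s" "\<lambda>i. q i r", OF sym]
        by (simp add: q'_def power2_eq_square)
      moreover have "quad p A (\<lambda>i. q' i s) (\<lambda>i. q' i s) = t\<^sup>2 * ?T r r - 2 * c * t * ?T r s + c\<^sup>2 * ?T s s"
        using rs quad_combination[of p A "-t" "\<lambda>i. q i r" c "\<lambda>i. q i s" "-t" "\<lambda>i. q i r" c "\<lambda>i. q i s"]
          quad_sym[of p A "\<lambda>i. q i s" "\<lambda>i. q i r", OF sym]
        by (simp add: q'_def power2_eq_square)
      moreover have c2: "c\<^sup>2 = 1 - t\<^sup>2" using ct by simp
      ultimately show ?thesis
        unfolding g_def c_def[symmetric] t_def[symmetric] by (simp add: c2 algebra_simps)
    qed
    moreover have "g 0 = 0" by (simp add: g_def)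
    moreover have "(g has_real_derivative (real r - real s) * (2 * ?T r s)) (at 0)"
      unfolding g_def by (auto intro!: derivative_eq_intros)
    ultimately have "(real r - real s) * (2 * ?T r s) = 0"
      by (intro DERIV_local_max[of g _ 0 1]) auto
    then show ?thesis using rs by simp
  qed
  then show ?thesis using q by blast
qed

text \<open>The eigenvalues \<open>d\<close> are unordered, unlike \<open>sigma\<close>. Row
  orthonormality of \<open>u\<close> follows from that of the columns, but it is recorded so that
  the identity matrix is visibly diagonal in the same basis.\<close>

definition spectral :: "nat \<Rightarrow> real mat \<Rightarrow> (nat \<Rightarrow> real) \<Rightarrow> (nat \<Rightarrow> nat \<Rightarrow> real) \<Rightarrow> bool" where
  "spectral p X d u \<longleftrightarrow> X \<in> carrier_mat p p \<and> ortho p u \<and>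
     (\<forall>i<p. \<forall>l<p. (\<Sum>j<p. u i j * u l j) = (if i = l then 1 else 0)) \<and>
     (\<forall>i<p. \<forall>l<p. X $$ (i, l) = (\<Sum>j<p. d j * u i j * u l j))"

lemma spectralD:
  assumes "spectral p X d u"
  shows "X \<in> carrier_mat p p" "ortho p u"
    "\<And>i l. i < p \<Longrightarrow> l < p \<Longrightarrow> (\<Sum>j<p. u i j * u l j) = (if i = l then 1 else 0)"
    "\<And>i l. i < p \<Longrightarrow> l < p \<Longrightarrow> X $$ (i, l) = (\<Sum>j<p. d j * u i j * u l j)"
    "\<And>j k. j < p \<Longrightarrow> k < p \<Longrightarrow> (\<Sum>i<p. u i j * u i k) = (if j = k then 1 else 0)"
  using assms by (auto simp: spectral_def ortho_def)

lemma conj_diag_entry: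
  assumes "i < p" "l < p"
  shows "(mat p p (\<lambda>(i, j). u i j) * mat_diag p d * transpose_mat (mat p p (\<lambda>(i, j). u i j))) $$ (i, l)
       = (\<Sum>j<p. d j * u i j * u l j :: real)"
  using assms
  by (subst mat_diag_mult_right[of _ p])
     (auto simp: scalar_prod_def atLeast0LessThan mult.commute mult.left_commute intro!: sum.cong)

lemma ortho_mat:
  assumes "ortho p u"
  defines "U \<equiv> mat p p (\<lambda>(i, j). u i j)"
  shows "transpose_mat U * U = 1\<^sub>m p" "U * transpose_mat U = 1\<^sub>m p"
proof -
  show 1: "transpose_mat U * U = 1\<^sub>m p"
    using assms(1) by (intro eq_matI) (auto simp: U_def ortho_def scalar_prod_def atLeast0LessThan)
  show "U * transpose_mat U = 1\<^sub>m p"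
    by (rule mat_mult_left_right_inverse[OF _ _ 1]) (auto simp: U_def)
qed

lemma spectral_iff_mat:
  "spectral p X d u \<longleftrightarrow> ortho p u \<and>
     X = mat p p (\<lambda>(i, j). u i j) * mat_diag p d * transpose_mat (mat p p (\<lambda>(i, j). u i j))"
  (is "_ \<longleftrightarrow> _ \<and> X = ?U * _ * _")
proof
  assume "spectral p X d u"
  note s = spectralD[OF this]
  show "ortho p u \<and> X = ?U * mat_diag p d * transpose_mat ?U"
    using s(1,2) by (auto intro!: eq_matI simp del: index_mult_mat(1) simp: conj_diag_entry s(4))
next
  assume *: "ortho p u \<and> X = ?U * mat_diag p d * transpose_mat ?U"
  have "(\<Sum>j<p. u i j * u l j) = (if i = l then 1 else 0)" if "i < p" "l < p" for i l
  proof -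
    have "(?U * transpose_mat ?U) $$ (i, l) = 1\<^sub>m p $$ (i, l)"
      using ortho_mat(2)[of p u] * by simp
    then show ?thesis using that by (simp add: scalar_prod_def atLeast0LessThan)
  qed
  moreover have "?U * mat_diag p d * transpose_mat ?U \<in> carrier_mat p p"
    by (intro mult_carrier_mat[of _ p p]) auto
  ultimately show "spectral p X d u"
    unfolding spectral_def using * by (simp del: index_mult_mat(1) add: conj_diag_entry)
qed

lemma spectral_exists:
  assumes X: "X \<in> carrier_mat p p" and sym: "transpose_mat X = X"
  shows "\<exists>d u. spectral p X d u"
proof -
  have "X $$ (i, l) = X $$ (l, i)" if "i < p" "l < p" for i l
    using index_transpose_mat(1)[of l X i] that X sym by (metis carrier_matD index_transpose_mat(1))
  from ortho_diagonalises[of p "\<lambda>i l. X $$ (i, l)", OF this]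
  obtain q where q: "ortho p q" and off:
    "\<And>r s. r < p \<Longrightarrow> s < p \<Longrightarrow> r \<noteq> s \<Longrightarrow> quad p (\<lambda>i l. X $$ (i, l)) (\<lambda>i. q i r) (\<lambda>i. q i s) = 0"
    by blast
  define Q where "Q = mat p p (\<lambda>(i, j). q i j)"
  define d where "d j = quad p (\<lambda>i l. X $$ (i, l)) (\<lambda>i. q i j) (\<lambda>i. q i j)" for j
  have Q: "Q \<in> carrier_mat p p" and Qt: "transpose_mat Q \<in> carrier_mat p p" by (auto simp: Q_def)
  have D: "transpose_mat Q * X * Q = mat_diag p d"
  proof (rule eq_matI)
    fix r s assume "r < dim_row (mat_diag p d)" "s < dim_col (mat_diag p d)"
    then have rs: "r < p" "s < p" by (auto simp: mat_diag_def)
    have "(transpose_mat Q * X * Q) $$ (r, s) = quad p (\<lambda>i l. X $$ (i, l)) (\<lambda>i. q i r) (\<lambda>i. q i s)"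
      using rs X unfolding quad_def
      by (subst sum.swap) (simp add: Q_def scalar_prod_def atLeast0LessThan sum_distrib_right)
    then show "(transpose_mat Q * X * Q) $$ (r, s) = mat_diag p d $$ (r, s)"
      using rs off by (auto simp: mat_diag_def d_def)
  qed (use Q in \<open>auto simp: mat_diag_def\<close>)
  have "Q * mat_diag p d * transpose_mat Q = (Q * transpose_mat Q) * X * (Q * transpose_mat Q)"
    unfolding D[symmetric] using Q Qt X
    by (simp add: assoc_mult_mat[of _ p p _ p _ p])
  also have "\<dots> = X" using ortho_mat(2)[OF q, folded Q_def] X by simp
  finally show ?thesis using spectral_iff_mat[of p X d q] q by (auto simp: Q_def)
qed

section \<open>Eigenvalue multisets and symmetric functions of the spectrum\<close>

lemma spectral_proots:
  assumes "spectral p X d u"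
  shows "proots (char_poly X) = mset (map d [0..<p])"
proof -
  define U where "U = mat p p (\<lambda>(i, j). u i j)"
  have X: "X = U * mat_diag p d * transpose_mat U" and o: "ortho p u"
    using assms by (auto simp: spectral_iff_mat U_def)
  have "similar_mat X (mat_diag p d)"
    using ortho_mat[OF o] spectralD(1)[OF assms]
    by (intro similar_matI[of _ _ U "transpose_mat U" p]) (auto simp: X U_def[symmetric], auto simp: U_def)
  then have "char_poly X = char_poly (mat_diag p d)" by (rule char_poly_similar)
  also have "\<dots> = (\<Prod>a\<leftarrow>diag_mat (mat_diag p d). [:- a, 1:])"
    by (rule char_poly_upper_triangular[of _ p]) (auto simp: mat_diag_def)
  also have "diag_mat (mat_diag p d) = map d [0..<p]"
    by (auto simp: diag_mat_def mat_diag_def)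
  finally have *: "char_poly X = (\<Prod>a\<leftarrow>map d [0..<p]. [:- a, 1:])" .
  have "proots (\<Prod>a\<leftarrow>xs. [:- a, 1:]) = mset xs" for xs :: "real list"
  proof (induction xs)
    case (Cons a xs)
    have "(\<Prod>a\<leftarrow>xs. [:- a, 1:]) \<noteq> 0" by (auto simp: prod_list_zero_iff)
    then have "proots (\<Prod>a\<leftarrow>a # xs. [:- a, 1:]) = proots [:- a, 1:] + proots (\<Prod>a\<leftarrow>xs. [:- a, 1:])"
      by (simp only: list.map prod_list.Cons, intro proots_mult) auto
    then show ?case using Cons by simp
  qed simp
  then show ?thesis by (simp only: *)
qed

lemma mset_eigs:
  assumes "spectral p X d u"
  shows "mset (eigs X) = mset (map d [0..<p])"
  by (simp add: eigs_def spectral_proots[OF assms])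

lemma length_eigs: "spectral p X d u \<Longrightarrow> length (eigs X) = p"
  by (metis mset_eigs mset_eq_length length_map length_upt diff_zero)

text \<open>Symmetric functions of the spectrum can be read off any diagonalisation, so the sorted
  order behind \<open>sigma\<close> never has to be tracked. The general codomain serves both the
  penalty and the count of nonzero eigenvalues.\<close>

lemma sum_sigma:
  fixes g :: "real \<Rightarrow> 'a::comm_monoid_add"
  assumes "spectral p X d u"
  shows "(\<Sum>j<p. g (sigma X j)) = (\<Sum>j<p. g (d j))"
proof -
  have "(\<Sum>j<p. g (sigma X j)) = sum_list (map g (eigs X))"
    by (simp add: sum_list_sum_nth length_eigs[OF assms] sigma_def atLeast0LessThan)
  also have "\<dots> = sum_mset (image_mset g (mset (eigs X)))"
    by (simp flip: sum_mset_sum_list mset_map)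
  also have "\<dots> = sum_list (map g (map d [0..<p]))"
    by (simp only: mset_eigs[OF assms] flip: sum_mset_sum_list mset_map)
  also have "\<dots> = (\<Sum>j<p. g (d j))"
    by (simp add: interv_sum_list_conv_sum_set_nat atLeast0LessThan comp_def)
  finally show ?thesis .
qed

lemma sigma_image:
  assumes "spectral p X d u"
  shows "sigma X ` {..<p} = d ` {..<p}"
proof -
  have "sigma X ` {..<p} = set (eigs X)"
    using length_eigs[OF assms] by (auto simp: sigma_def set_conv_nth image_def)
  also have "\<dots> = d ` {..<p}"
    using mset_eigs[OF assms] by (metis atLeast_upt list.set_map set_mset_mset)
  finally show ?thesis .
qed

lemma spectral_quad:
  assumes "spectral p X d u"
  shows "quad p (\<lambda>i l. X $$ (i, l)) w w = (\<Sum>j<p. d j * (\<Sum>i<p. w i * u i j)\<^sup>2)"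
proof -
  have "quad p (\<lambda>i l. X $$ (i, l)) w w = (\<Sum>i<p. \<Sum>l<p. \<Sum>j<p. d j * ((w i * u i j) * (w l * u l j)))"
    unfolding quad_def using spectralD(4)[OF assms]
    by (intro sum.cong) (auto simp: sum_distrib_left sum_distrib_right algebra_simps)
  also have "\<dots> = (\<Sum>i<p. \<Sum>j<p. \<Sum>l<p. d j * ((w i * u i j) * (w l * u l j)))"
    by (intro sum.cong refl sum.swap)
  also have "\<dots> = (\<Sum>j<p. \<Sum>i<p. \<Sum>l<p. d j * ((w i * u i j) * (w l * u l j)))"
    by (rule sum.swap)
  also have "\<dots> = (\<Sum>j<p. d j * (\<Sum>i<p. w i * u i j)\<^sup>2)"
    unfolding power2_eq_square sum_product by (simp only: sum_distrib_left)
  finally show ?thesis .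
qed

lemma spectral_quad_eigenvector:
  assumes "spectral p X d u" "k < p"
  shows "quad p (\<lambda>i l. X $$ (i, l)) (\<lambda>i. u i k) (\<lambda>i. u i k) = d k"
proof -
  have "quad p (\<lambda>i l. X $$ (i, l)) (\<lambda>i. u i k) (\<lambda>i. u i k) = (\<Sum>j<p. if j = k then d j else 0)"
    unfolding spectral_quad[OF assms(1)]
    using spectralD(5)[OF assms(1) assms(2)] by (intro sum.cong) auto
  then show ?thesis using assms by simp
qed

lemma Sp_quad_nonneg:
  assumes "X \<in> Sp p"
  shows "quad p (\<lambda>i l. X $$ (i, l)) w w \<ge> 0"
proof -
  have X: "X \<in> carrier_mat p p" using assms by (simp add: Sp_def)
  have "scalar_prod (vec p w) (X *\<^sub>v vec p w) \<ge> 0" using assms by (auto simp: Sp_def)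
  also have "scalar_prod (vec p w) (X *\<^sub>v vec p w) = quad p (\<lambda>i l. X $$ (i, l)) w w"
    using X by (auto simp: quad_def scalar_prod_def atLeast0LessThan sum_distrib_left mult.assoc intro!: sum.cong)
  finally show ?thesis .
qed

lemma Sp_spectral:
  assumes "X \<in> Sp p"
  obtains d u where "spectral p X d u" "\<And>j. j < p \<Longrightarrow> d j \<ge> 0"
proof -
  have "X \<in> carrier_mat p p" "transpose_mat X = X" using assms by (auto simp: Sp_def)
  then obtain d u where s: "spectral p X d u" using spectral_exists by blast
  have "d j \<ge> 0" if "j < p" for j
    using Sp_quad_nonneg[OF assms] spectral_quad_eigenvector[OF s that] by metis
  with s that show ?thesis by blast
qed

text \<open>X^T X has the eigenvalues d_j^2 in the same basis, and nonnegativity makes the square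
  root return d_j.\<close>

lemma nuc_norm_spectral:
  assumes s: "spectral p X d u" and nn: "\<And>j. j < p \<Longrightarrow> d j \<ge> 0"
  shows "nuc_norm X = (\<Sum>j<p. d j)"
proof -
  define U where "U = mat p p (\<lambda>(i, j). u i j)"
  have X: "X = U * mat_diag p d * transpose_mat U" and o: "ortho p u"
    using s by (auto simp: spectral_iff_mat U_def)
  have U: "U \<in> carrier_mat p p" and Ut: "transpose_mat U \<in> carrier_mat p p"
    and D: "mat_diag p d \<in> carrier_mat p p" by (auto simp: U_def)
  have cl: "A * B \<in> carrier_mat p p" if "A \<in> carrier_mat p p" "B \<in> carrier_mat p p" for A B :: "real mat"
    using that by simp
  have "transpose_mat (mat_diag p d) = mat_diag p d" by (auto simp: mat_diag_def)
  then have "transpose_mat X = X"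
    unfolding X using U Ut D transpose_mult[OF U D] transpose_mult[OF mult_carrier_mat[OF U D] Ut]
    by (simp add: assoc_mult_mat[of _ p p _ p _ p])
  moreover have "X * X = U * mat_diag p d * (transpose_mat U * U) * mat_diag p d * transpose_mat U"
    unfolding X using U Ut D by (simp add: cl assoc_mult_mat[of _ p p _ p _ p])
  moreover have "\<dots> = U * mat_diag p (\<lambda>j. d j * d j) * transpose_mat U"
    using ortho_mat(1)[OF o, folded U_def] U Ut D
    by (simp add: cl left_mult_one_mat[of _ p p] assoc_mult_mat[of _ p p _ p _ p] flip: mat_diag_diag)
  ultimately have "spectral p (transpose_mat X * X) (\<lambda>j. d j * d j) u"
    using o by (simp add: spectral_iff_mat U_def)
  then have "nuc_norm X = sum_mset (image_mset sqrt (mset (map (\<lambda>j. d j * d j) [0..<p])))"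
    by (simp only: nuc_norm_def spectral_proots)
  also have "\<dots> = sum_list (map (\<lambda>j. sqrt (d j * d j)) [0..<p])"
    by (simp only: map_map comp_def flip: sum_mset_sum_list mset_map)
  also have "\<dots> = (\<Sum>j<p. d j)"
    using nn by (auto simp: interv_sum_list_conv_sum_set_nat atLeast0LessThan intro!: sum.cong)
  finally show ?thesis .
qed

text \<open>Adding the projection onto the kernel makes the matrix invertible; subadditivity of the rank
  then bounds the rank from below.\<close>
lemma card_nonzero_le_rank:
  assumes s: "spectral p X d u"
  shows "card {j. j < p \<and> d j \<noteq> 0} \<le> mat_rank p X"
proof -
  define Y where "Y J = mat p p (\<lambda>(i, l). \<Sum>j\<in>J. u i j * u l j)" for J
  interpret vec_space "TYPE(real)" p .
  \<comment> \<open>Each outer product of an eigenvector with itself has rank at most 1.\<close>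
  have rank_Y: "rank (Y J) \<le> card J" if "finite J" for J
    using that
  proof (induction J)
    case empty
    have "Y {} = 0\<^sub>m p p" by (auto simp: Y_def)
    then show ?case by (simp add: rank_0I)
  next
    case (insert k J)
    have "Y (insert k J) = Y {k} + Y J" using insert by (auto simp: Y_def)
    moreover have "rank (Y {k}) \<le> 1"
      by (rule rank_le_1_product_entries[of _ p "\<lambda>i. u i k" "\<lambda>l. u l k"]) (auto simp: Y_def)
    ultimately show ?case
      using rank_subadditive[of "Y {k}" p "Y J"] insert by (simp add: Y_def)
  qed
  \<comment> \<open>The spectrum after adding the kernel projection: zeros become 1, hence the
    determinant is nonzero.\<close>
  define e where "e j = (if d j = 0 then 1 else d j)" for j
  have X: "X \<in> carrier_mat p p" using s by (rule spectralD)
  have "spectral p (X + Y {j. j < p \<and> d j = 0}) e u"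
  proof -
    have "(\<Sum>j\<in>{j. j < p \<and> d j = 0}. u i j * u l j) + (\<Sum>j<p. d j * u i j * u l j) = (\<Sum>j<p. e j * u i j * u l j)" for i l
    proof -
      have "(\<Sum>j\<in>{j. j < p \<and> d j = 0}. u i j * u l j) = (\<Sum>j<p. if d j = 0 then u i j * u l j else 0)"
        by (subst sum.inter_filter[symmetric]) auto
      then have "(\<Sum>j\<in>{j. j < p \<and> d j = 0}. u i j * u l j) + (\<Sum>j<p. d j * u i j * u l j)
          = (\<Sum>j<p. (if d j = 0 then u i j * u l j else 0) + d j * u i j * u l j)"
        by (simp only: sum.distrib)
      also have "\<dots> = (\<Sum>j<p. e j * u i j * u l j)" by (rule sum.cong) (auto simp: e_def)
      finally show ?thesis .
    qed
    then show ?thesis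
      using X spectralD[OF s] by (auto simp: spectral_def Y_def add.commute)
  qed
  then have e: "X + Y {j. j < p \<and> d j = 0} = mat p p (\<lambda>(i, j). u i j) * mat_diag p e * transpose_mat (mat p p (\<lambda>(i, j). u i j))"
    (is "_ = ?U * _ * _") and o: "ortho p u"
    by (auto simp: spectral_iff_mat)
  have "det (mat_diag p e) = prod_list (diag_mat (mat_diag p e))"
    by (rule det_upper_triangular[of _ p]) (auto simp: mat_diag_def)
  also have "\<dots> \<noteq> 0" by (auto simp: prod_list_zero_iff diag_mat_def mat_diag_def e_def)
  finally have "det (mat_diag p e) \<noteq> 0" .
  moreover have "det ?U * det (transpose_mat ?U) = 1"
    using ortho_mat(2)[OF o] by (simp flip: det_mult[of _ p])
  then have "det ?U \<noteq> 0" "det (transpose_mat ?U) \<noteq> 0" by auto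
  ultimately have "det (X + Y {j. j < p \<and> d j = 0}) \<noteq> 0"
  proof -
    have "det (?U * mat_diag p e * transpose_mat ?U) = det (?U * mat_diag p e) * det (transpose_mat ?U)"
      by (rule det_mult[of _ p]) (auto intro!: mult_carrier_mat[of _ p p])
    also have "det (?U * mat_diag p e) = det ?U * det (mat_diag p e)"
      by (rule det_mult[of _ p]) auto
    finally show "det (mat_diag p e) \<noteq> 0 \<Longrightarrow> det ?U \<noteq> 0 \<Longrightarrow> det (transpose_mat ?U) \<noteq> 0 \<Longrightarrow>
        det (X + Y {j. j < p \<and> d j = 0}) \<noteq> 0"
      unfolding e by simp
  qed
  then have "rank (X + Y {j. j < p \<and> d j = 0}) = p"
    using X by (intro low_rank_det_zero) (auto simp: Y_def)
  then have "p \<le> rank X + card {j. j < p \<and> d j = 0}"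
    using rank_subadditive[of X p "Y {j. j < p \<and> d j = 0}"] rank_Y[of "{j. j < p \<and> d j = 0}"] X
    by (simp add: Y_def)
  moreover have "p = card {j. j < p \<and> d j \<noteq> 0} + card {j. j < p \<and> d j = 0}"
  proof -
    have "{..<p} = {j. j < p \<and> d j \<noteq> 0} \<union> {j. j < p \<and> d j = 0}" by auto
    then have "card {..<p} = card ({j. j < p \<and> d j \<noteq> 0} \<union> {j. j < p \<and> d j = 0})" by simp
    also have "\<dots> = card {j. j < p \<and> d j \<noteq> 0} + card {j. j < p \<and> d j = 0}"
      by (rule card_Un_disjoint) auto
    finally show ?thesis by simp
  qed
  ultimately show ?thesis by (simp add: mat_rank_def)
qed

section \<open>Frobenius norm and Lipschitz continuity of the spectral penalty\<close>

lemma frob_nonneg [simp]: "frob X \<ge> 0"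
  by (auto simp: frob_def intro!: sum_nonneg)

lemma entry_le_frob:
  assumes "X \<in> carrier_mat p p" "i < p" "l < p"
  shows "\<bar>X $$ (i, l)\<bar> \<le> frob X"
proof -
  have "(X $$ (i, l))\<^sup>2 \<le> (\<Sum>l<p. (X $$ (i, l))\<^sup>2)"
    using assms by (intro member_le_sum) auto
  also have "\<dots> \<le> (\<Sum>i<p. \<Sum>l<p. (X $$ (i, l))\<^sup>2)"
    using assms by (intro member_le_sum[where f = "\<lambda>i. \<Sum>l<p. (X $$ (i, l))\<^sup>2"]) (auto intro: sum_nonneg)
  finally have "sqrt ((X $$ (i, l))\<^sup>2) \<le> sqrt (\<Sum>i<p. \<Sum>l<p. (X $$ (i, l))\<^sup>2)"
    by (rule real_sqrt_le_mono)
  then show ?thesis using assms by (simp add: frob_def)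
qed

lemma frob_le:
  assumes "X \<in> carrier_mat p p" "b \<ge> 0" "\<And>i l. i < p \<Longrightarrow> l < p \<Longrightarrow> \<bar>X $$ (i, l)\<bar> \<le> b"
  shows "frob X \<le> real p * b"
proof -
  have "(\<Sum>i<p. \<Sum>l<p. (X $$ (i, l))\<^sup>2) \<le> (\<Sum>i<p. \<Sum>l<p. b\<^sup>2)"
    using assms by (intro sum_mono) (auto simp: abs_le_square_iff[symmetric])
  also have "\<dots> = (real p * b)\<^sup>2" by (simp add: power2_eq_square)
  finally have "sqrt (\<Sum>i<p. \<Sum>l<p. (X $$ (i, l))\<^sup>2) \<le> sqrt ((real p * b)\<^sup>2)" by (rule real_sqrt_le_mono)
  then show ?thesis using assms by (simp add: frob_def)
qed

lemma frob_minus_commute: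
  assumes "X \<in> carrier_mat p p" "Y \<in> carrier_mat p p"
  shows "frob (X - Y) = frob (Y - X)"
  using assms by (simp add: frob_def power2_commute)

lemma Sp_carrier: "X \<in> Sp p \<Longrightarrow> X \<in> carrier_mat p p"
  by (simp add: Sp_def)

text \<open>A crude entrywise estimate. Its factor p^2 only enters a Lipschitz constant used for
  continuity and never reaches the rates.\<close>

lemma abs_quad_le:
  assumes X: "X \<in> carrier_mat p p" and w: "\<And>i. i < p \<Longrightarrow> \<bar>w i\<bar> \<le> 1"
  shows "\<bar>quad p (\<lambda>i l. X $$ (i, l)) w w\<bar> \<le> (real p)\<^sup>2 * frob X"
proof -
  have "\<bar>quad p (\<lambda>i l. X $$ (i, l)) w w\<bar> \<le> (\<Sum>i<p. \<Sum>l<p. \<bar>w i * X $$ (i, l) * w l\<bar>)"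
    unfolding quad_def by (rule order_trans[OF sum_abs sum_mono]) (rule sum_abs)
  also have "\<dots> \<le> (\<Sum>i<p. \<Sum>l<p. frob X)"
  proof (intro sum_mono)
    fix i l assume il: "i \<in> {..<p}" "l \<in> {..<p}"
    have "\<bar>w i * X $$ (i, l) * w l\<bar> \<le> 1 * frob X * 1"
      unfolding abs_mult using il w entry_le_frob[OF X] by (intro mult_mono) auto
    then show "\<bar>w i * X $$ (i, l) * w l\<bar> \<le> frob X" by simp
  qed
  also have "\<dots> = (real p)\<^sup>2 * frob X" by (simp add: power2_eq_square)
  finally show ?thesis .
qed

definition pen :: "nat \<Rightarrow> real \<Rightarrow> real \<Rightarrow> real mat \<Rightarrow> real" where
  "pen p a lam X = (\<Sum>j<p. MCP a lam (sigma X j))"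

lemma pen_spectral:
  assumes "a > 0" "lam \<ge> 0" "spectral p X d u" "\<And>j. j < p \<Longrightarrow> d j \<ge> 0"
  shows "pen p a lam X = (\<Sum>j<p. mcp_form a lam (d j))"
  unfolding pen_def sum_sigma[OF assms(3)] using assms by (intro sum.cong) (auto simp: MCP_eq)

text \<open>By concavity, the penalty of the spectrum of X is at most that of the diagonal of X in any
  orthonormal basis; taking the eigenbasis of Y compares the two spectra.\<close>
lemma pen_diff_le:
  assumes a: "a > 0" and lam: "lam \<ge> 0" and X: "X \<in> Sp p" and Y: "Y \<in> Sp p"
  shows "pen p a lam X - pen p a lam Y \<le> lam * real p ^ 3 * frob (X - Y)"
proof -
  obtain d u where s: "spectral p X d u" and d: "\<And>j. j < p \<Longrightarrow> d j \<ge> 0"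
    using Sp_spectral[OF X] by metis
  obtain e v where t: "spectral p Y e v" and e: "\<And>j. j < p \<Longrightarrow> e j \<ge> 0"
    using Sp_spectral[OF Y] by metis
  define \<phi> where "\<phi> = mcp_form a lam"
  have penX: "pen p a lam X = (\<Sum>j<p. \<phi> (d j))" unfolding \<phi>_def by (rule pen_spectral) fact+
  have penY: "pen p a lam Y = (\<Sum>j<p. \<phi> (e j))" unfolding \<phi>_def by (rule pen_spectral) fact+
  \<comment> \<open>A doubly stochastic matrix. Its row sums make \<open>g i\<close> a convex
    combination of the eigenvalues of X; its column sums recover the total penalty of X after
    summing Jensen's inequality.\<close>
  define w where "w i j = (\<Sum>m<p. v m i * u m j)\<^sup>2" for i j
  define g where "g i = quad p (\<lambda>i l. X $$ (i, l)) (\<lambda>m. v m i) (\<lambda>m. v m i)" for i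
  have g: "g i = (\<Sum>j<p. w i j * d j)" for i
    unfolding g_def spectral_quad[OF s] w_def by (simp add: mult.commute)
  \<comment> \<open>Every orthonormal basis diagonalises the identity, so row and column sums of
    \<open>w\<close> are quadratic forms of the identity at unit vectors.\<close>
  have one: "spectral p (1\<^sub>m p) (\<lambda>j. 1) u'" if "spectral p Z d' u'" for Z d' u'
    using spectralD[OF that] by (auto simp: spectral_def)
  have w_rows: "(\<Sum>j<p. w i j) = 1" if "i < p" for i
  proof -
    have "(\<Sum>j<p. w i j) = quad p (\<lambda>i l. 1\<^sub>m p $$ (i, l)) (\<lambda>m. v m i) (\<lambda>m. v m i)"
      unfolding spectral_quad[OF one[OF s]] w_def by simp
    also have "\<dots> = 1" by (rule spectral_quad_eigenvector[OF one[OF t] that])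
    finally show ?thesis .
  qed
  have w_cols: "(\<Sum>i<p. w i j) = 1" if "j < p" for j
  proof -
    have "(\<Sum>i<p. w i j) = quad p (\<lambda>i l. 1\<^sub>m p $$ (i, l)) (\<lambda>m. u m j) (\<lambda>m. u m j)"
      unfolding spectral_quad[OF one[OF t]] w_def by (simp add: mult.commute)
    also have "\<dots> = 1" by (rule spectral_quad_eigenvector[OF one[OF s] that])
    finally show ?thesis .
  qed
  have jensen: "(\<Sum>j<p. w i j * \<phi> (d j)) \<le> \<phi> (g i)" if i: "i < p" for i
  proof -
    define m where "m = max (a * lam - g i) 0 / a"
    have "(\<Sum>j<p. w i j * \<phi> (d j)) \<le> (\<Sum>j<p. w i j * (\<phi> (g i) + m * (d j - g i)))"
      unfolding \<phi>_def m_def by (intro sum_mono mult_left_mono mcp_form_tangent a) (simp add: w_def)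
    also have "\<dots> = (\<Sum>j<p. w i j) * (\<phi> (g i) - m * g i) + m * (\<Sum>j<p. w i j * d j)"
      unfolding sum_distrib_left sum_distrib_right sum.distrib[symmetric]
      by (intro sum.cong refl) (simp add: algebra_simps)
    also have "\<dots> = \<phi> (g i)" using w_rows[OF i] g[of i] by simp
    finally show ?thesis .
  qed
  have "pen p a lam X = (\<Sum>j<p. (\<Sum>i<p. w i j) * \<phi> (d j))"
    unfolding penX using w_cols by (intro sum.cong) auto
  also have "\<dots> = (\<Sum>i<p. \<Sum>j<p. w i j * \<phi> (d j))"
    unfolding sum_distrib_right by (rule sum.swap)
  also have "\<dots> \<le> (\<Sum>i<p. \<phi> (g i))" using jensen by (intro sum_mono) auto
  finally have "pen p a lam X - pen p a lam Y \<le> (\<Sum>i<p. \<phi> (g i) - \<phi> (e i))"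
    unfolding penY by (simp add: sum_subtractf)
  also have "\<dots> \<le> (\<Sum>i<p. lam * ((real p)\<^sup>2 * frob (X - Y)))"
  proof (intro sum_mono)
    fix i assume "i \<in> {..<p}"
    then have i: "i < p" by simp
    have c: "X \<in> carrier_mat p p" "Y \<in> carrier_mat p p" using X Y by (auto intro: Sp_carrier)
    have "g i - e i = g i - quad p (\<lambda>i l. Y $$ (i, l)) (\<lambda>m. v m i) (\<lambda>m. v m i)"
      by (simp add: spectral_quad_eigenvector[OF t i])
    also have "\<dots> = quad p (\<lambda>i l. (X - Y) $$ (i, l)) (\<lambda>m. v m i) (\<lambda>m. v m i)"
      unfolding g_def quad_def using c by (simp add: algebra_simps flip: sum_subtractf)
    finally have "\<bar>g i - e i\<bar> = \<bar>quad p (\<lambda>i l. (X - Y) $$ (i, l)) (\<lambda>m. v m i) (\<lambda>m. v m i)\<bar>" by simp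
    also have "\<dots> \<le> (real p)\<^sup>2 * frob (X - Y)"
      using c ortho_entry_le[OF spectralD(2)[OF t]] i by (intro abs_quad_le) auto
    finally have "lam * \<bar>g i - e i\<bar> \<le> lam * ((real p)\<^sup>2 * frob (X - Y))"
      using lam by (intro mult_left_mono) auto
    moreover have "\<phi> (g i) - \<phi> (e i) \<le> lam * \<bar>g i - e i\<bar>"
      unfolding \<phi>_def using a lam e[OF i] by (rule mcp_form_diff_le)
    ultimately show "\<phi> (g i) - \<phi> (e i) \<le> lam * ((real p)\<^sup>2 * frob (X - Y))" by linarith
  qed
  also have "\<dots> = lam * real p ^ 3 * frob (X - Y)"
    by (simp add: power2_eq_square power3_eq_cube algebra_simps)
  finally show ?thesis .
qed

lemma abs_pen_diff_le:
  assumes "a > 0" "lam \<ge> 0" "X \<in> Sp p" "Y \<in> Sp p"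
  shows "\<bar>pen p a lam X - pen p a lam Y\<bar> \<le> lam * real p ^ 3 * frob (X - Y)"
  using pen_diff_le[OF assms] pen_diff_le[OF assms(1,2,4,3)]
    frob_minus_commute[of X p Y] assms(3,4)[THEN Sp_carrier] by auto

section \<open>Eigenvalues and the spectral norm\<close>

lemma spectral_mult_eigenvector:
  assumes s: "spectral p X d u" and k: "k < p"
  shows "X *\<^sub>v vec p (\<lambda>i. u i k) = d k \<cdot>\<^sub>v vec p (\<lambda>i. u i k)"
proof (rule eq_vecI)
  note X = spectralD(1)[OF s]
  fix i assume "i < dim_vec (d k \<cdot>\<^sub>v vec p (\<lambda>i. u i k))"
  then have i: "i < p" by simp
  have "(X *\<^sub>v vec p (\<lambda>i. u i k)) $ i = (\<Sum>l<p. (\<Sum>j<p. d j * u i j * u l j) * u l k)"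
    using X i spectralD(4)[OF s i] by (simp add: scalar_prod_def atLeast0LessThan)
  also have "\<dots> = (\<Sum>j<p. d j * u i j * (\<Sum>l<p. u l j * u l k))"
    unfolding sum_distrib_left sum_distrib_right by (subst sum.swap) (simp add: mult.assoc)
  also have "\<dots> = (\<Sum>j<p. if j = k then d j * u i j else 0)"
    using spectralD(5)[OF s _ k] by (intro sum.cong) auto
  finally show "(X *\<^sub>v vec p (\<lambda>i. u i k)) $ i = (d k \<cdot>\<^sub>v vec p (\<lambda>i. u i k)) $ i"
    using k i by simp
qed (use spectralD(1)[OF s] in auto)

lemma eigenvalue_le_sigma_max:
  assumes s: "spectral p X d u" and k: "k < p"
  shows "d k \<le> sigma_max X"
proof -
  note X = spectralD(1)[OF s]
  let ?N = "{sqrt (scalar_prod (X *\<^sub>v v) (X *\<^sub>v v)) | v. v \<in> carrier_vec (dim_col X) \<and> scalar_prod v v \<le> 1}"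
  \<comment> \<open>A real supremum dominates its members only for a bounded set, so a crude bound
    on |Xv| over the unit ball comes before evaluation at a unit eigenvector.\<close>
  have "bdd_above ?N"
  proof (rule bdd_aboveI)
    fix x assume "x \<in> ?N"
    then obtain v where x: "x = sqrt (scalar_prod (X *\<^sub>v v) (X *\<^sub>v v))" and v: "v \<in> carrier_vec p"
      and vv: "scalar_prod v v \<le> 1"
      using X by auto
    have v1: "\<bar>v $ l\<bar> \<le> 1" if "l < p" for l
    proof -
      have "(v $ l)\<^sup>2 \<le> (\<Sum>l<p. (v $ l)\<^sup>2)" using that by (intro member_le_sum) auto
      also have "\<dots> \<le> 1" using vv v by (simp add: scalar_prod_def atLeast0LessThan power2_eq_square)
      finally show ?thesis by (simp add: abs_square_le_1)
    qed
    have "\<bar>(X *\<^sub>v v) $ i\<bar> \<le> real p * frob X" if i: "i < p" for i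
    proof -
      have "\<bar>(X *\<^sub>v v) $ i\<bar> \<le> (\<Sum>l<p. \<bar>X $$ (i, l) * v $ l\<bar>)"
        using X v i by (simp add: scalar_prod_def atLeast0LessThan)
      also have "\<dots> \<le> (\<Sum>l<p. frob X * 1)"
        unfolding abs_mult using v1 entry_le_frob[OF X i] by (intro sum_mono mult_mono) auto
      finally show ?thesis by simp
    qed
    then have "(\<Sum>i<p. ((X *\<^sub>v v) $ i)\<^sup>2) \<le> (\<Sum>i<p. (real p * frob X)\<^sup>2)"
      by (intro sum_mono) (auto simp: abs_le_square_iff[symmetric])
    then show "x \<le> sqrt (\<Sum>i<p. (real p * frob X)\<^sup>2)"
      unfolding x using X v by (simp add: scalar_prod_def atLeast0LessThan power2_eq_square)
  qed
  moreover define v where "v = vec p (\<lambda>i. u i k)"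
  have vv: "scalar_prod v v = 1"
    using spectralD(5)[OF s k k] by (simp add: v_def scalar_prod_def atLeast0LessThan)
  have "sqrt (scalar_prod (X *\<^sub>v v) (X *\<^sub>v v)) = \<bar>d k\<bar>"
    unfolding v_def spectral_mult_eigenvector[OF s k] using vv[unfolded v_def] by simp
  then have "\<bar>d k\<bar> \<in> ?N" using vv X by (auto simp: v_def intro!: exI[of _ v])
  ultimately have "\<bar>d k\<bar> \<le> Sup ?N" by (intro cSup_upper)
  then show ?thesis by (simp add: sigma_max_def)
qed

section \<open>Nets of low-rank matrices\<close>

lemma frob_eq_L2_set:
  assumes "X \<in> carrier_mat p p"
  shows "frob X = L2_set (\<lambda>il. X $$ il) ({..<p} \<times> {..<p})"
  using assms by (simp add: frob_def L2_set_def sum.cartesian_product split_def)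

lemma frob_triangle:
  assumes "X \<in> carrier_mat p p" "Y \<in> carrier_mat p p" "Z \<in> carrier_mat p p"
  shows "frob (X - Z) \<le> frob (X - Y) + frob (Y - Z)"
proof -
  have "frob (X - Z) = L2_set (\<lambda>il. (X - Y) $$ il + (Y - Z) $$ il) ({..<p} \<times> {..<p})"
    using assms by (subst frob_eq_L2_set[of _ p]) (auto intro!: L2_set_cong)
  also have "\<dots> \<le> frob (X - Y) + frob (Y - Z)"
    using assms by (subst (1 2) frob_eq_L2_set[of _ p]) (auto intro!: L2_set_triangle_ineq)
  finally show ?thesis .
qed

text \<open>This count acts as the rank of the estimator: the penalty and the factor B both see the
  rank through it. \<open>mat_rank\<close> enters at the true minimiser, as an upper bound for the
  same count.\<close>

definition nz :: "nat \<Rightarrow> real mat \<Rightarrow> nat" where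
  "nz p X = card {j. j < p \<and> sigma X j \<noteq> 0}"

lemma nz_spectral:
  assumes "spectral p X d u"
  shows "nz p X = card {j. j < p \<and> d j \<noteq> 0}"
proof -
  have *: "card {j. j < p \<and> h j \<noteq> 0} = (\<Sum>j<p. if h j \<noteq> 0 then 1 else 0)" for h :: "nat \<Rightarrow> real"
    by (simp add: sum.inter_filter[symmetric])
  show ?thesis unfolding nz_def * by (rule sum_sigma[OF assms])
qed

lemma nz_le: "nz p X \<le> p"
  unfolding nz_def using card_mono[of "{..<p}" "{j. j < p \<and> sigma X j \<noteq> 0}"] by auto

text \<open>The columns of B are sqrt(d_j) u_j over the nonzero d_j, renumbered by \<open>h\<close>.
  Since |u_ij| \<le> 1, the entries lie in a box of half-width sqrt R, which the net
  discretises.\<close>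

lemma low_rank_factor:
  assumes X: "X \<in> Sp p" and R: "sigma_max X \<le> R"
  shows "\<exists>B. (\<forall>i<p. \<forall>j<nz p X. \<bar>B i j\<bar> \<le> sqrt R) \<and>
    (\<forall>i<p. \<forall>l<p. X $$ (i, l) = (\<Sum>j<nz p X. B i j * B l j))"
proof -
  obtain d u where s: "spectral p X d u" and d: "\<And>j. j < p \<Longrightarrow> d j \<ge> 0"
    using Sp_spectral[OF X] by metis
  define J where "J = {j. j < p \<and> d j \<noteq> 0}"
  have "finite J" by (simp add: J_def)
  then obtain h where h: "bij_betw h {0..<card J} J" using ex_bij_betw_nat_finite by blast
  have k: "nz p X = card J" unfolding J_def by (rule nz_spectral[OF s])
  have hJ: "h j \<in> J" if "j < nz p X" for j
    using bij_betwE[OF h] that k by auto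
  define B where "B i j = sqrt (d (h j)) * u i (h j)" for i j
  show ?thesis
  proof (intro exI[of _ B] conjI allI impI)
    fix i j assume ij: "i < p" "j < nz p X"
    have hj: "h j < p" using hJ[OF ij(2)] by (simp add: J_def)
    have "d (h j) \<le> R" using eigenvalue_le_sigma_max[OF s hj] R by simp
    then have "sqrt (d (h j)) * \<bar>u i (h j)\<bar> \<le> sqrt R * 1"
      using d[OF hj] ortho_entry_le[OF spectralD(2)[OF s] ij(1) hj] by (intro mult_mono) auto
    then show "\<bar>B i j\<bar> \<le> sqrt R" using d[OF hj] by (simp add: B_def abs_mult)
  next
    fix i l assume il: "i < p" "l < p"
    have "(\<Sum>j<nz p X. B i j * B l j) = (\<Sum>j\<in>{0..<card J}. d (h j) * u i (h j) * u l (h j))"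
    proof (rule sum.cong)
      fix j assume "j \<in> {0..<card J}"
      then have "d (h j) \<ge> 0" using hJ d k by (auto simp: J_def)
      then show "B i j * B l j = d (h j) * u i (h j) * u l (h j)"
        by (simp add: B_def mult.assoc mult.left_commute)
    qed (auto simp: k)
    also have "\<dots> = (\<Sum>j\<in>J. d j * u i j * u l j)"
      by (rule sum.reindex_bij_betw[OF h, where g = "\<lambda>j. d j * u i j * u l j"])
    also have "\<dots> = (\<Sum>j<p. d j * u i j * u l j)"
      by (rule sum.mono_neutral_left) (auto simp: J_def)
    finally show "X $$ (i, l) = (\<Sum>j<nz p X. B i j * B l j)" using spectralD(4)[OF s il] by simp
  qed
qed

text \<open>One point is kept per nonempty fibre of \<open>g\<close>. Rounding could leave S,
  whereas representatives stay in it, so Bernstein's inequality and A4 apply at the net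
  points.\<close>

lemma representatives:
  obtains N where "N \<subseteq> S" "\<And>x. x \<in> S \<Longrightarrow> \<exists>y\<in>N. g y = g x" "inj_on g N"
proof
  let ?N = "inv_into S g ` (g ` S)"
  show "?N \<subseteq> S" by (auto intro: inv_into_into)
  show "\<exists>y\<in>?N. g y = g x" if "x \<in> S" for x
    using that by (intro bexI[of _ "inv_into S g (g x)"]) (auto simp: f_inv_into_f)
  show "inj_on g ?N" by (auto simp: inj_on_def f_inv_into_f)
qed

lemma floor_eq_imp_diff_le:
  fixes x y \<delta> :: real
  assumes "\<delta> > 0" "\<lfloor>x / \<delta>\<rfloor> = \<lfloor>y / \<delta>\<rfloor>"
  shows "\<bar>x - y\<bar> \<le> \<delta>"
proof -
  have "\<bar>x / \<delta> - y / \<delta>\<bar> \<le> 1" using assms(2) by linarith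
  then have "\<bar>x - y\<bar> / \<delta> \<le> 1" using assms(1) by (simp flip: diff_divide_distrib)
  then show ?thesis using assms(1) by simp
qed

text \<open>The cells live on the p k entries of the factor, not on the p^2 entries of X; this makes
  the entropy proportional to the rank. Each entry falls into one of 2M+1 intervals of length
  \<delta>.\<close>

lemma low_rank_net:
  assumes p: "p \<ge> 1" and R: "R \<ge> 1" and \<epsilon>: "\<epsilon> > 0" and k: "k \<le> p" and M: "2 * (real p)\<^sup>2 * R / \<epsilon> \<le> real M"
  shows "\<exists>N. finite N \<and> N \<subseteq> {X \<in> Sp p. sigma_max X \<le> R} \<and> card N \<le> (2 * M + 1) ^ (p * k) \<and>
    (\<forall>X\<in>Sp p. sigma_max X \<le> R \<longrightarrow> nz p X = k \<longrightarrow> (\<exists>Y\<in>N. frob (X - Y) \<le> \<epsilon>))"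
proof -
  define S where "S = {X \<in> Sp p. sigma_max X \<le> R \<and> nz p X = k}"
  \<comment> \<open>Solves p (2 p sqrt R \<delta>) = \<epsilon>, the error bound obtained below;
    then sqrt R / \<delta> = 2 p^2 R / \<epsilon>, the number that M has to dominate.\<close>
  define \<delta> where "\<delta> = \<epsilon> / (2 * (real p)\<^sup>2 * sqrt R)"
  have \<delta>: "\<delta> > 0" using p R \<epsilon> by (auto simp: \<delta>_def)
  have "\<forall>X\<in>S. \<exists>B. (\<forall>i<p. \<forall>j<k. \<bar>B i j\<bar> \<le> sqrt R) \<and> (\<forall>i<p. \<forall>l<p. X $$ (i, l) = (\<Sum>j<k. B i j * B l j))"
    using low_rank_factor by (force simp: S_def)
  then obtain B where B: "\<And>X i j. X \<in> S \<Longrightarrow> i < p \<Longrightarrow> j < k \<Longrightarrow> \<bar>B X i j\<bar> \<le> sqrt R"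
    and XB: "\<And>X i l. X \<in> S \<Longrightarrow> i < p \<Longrightarrow> l < p \<Longrightarrow> X $$ (i, l) = (\<Sum>j<k. B X i j * B X l j)"
    by metis
  define g where "g X = (\<lambda>ij\<in>{..<p} \<times> {..<k}. \<lfloor>B X (fst ij) (snd ij) / \<delta>\<rfloor>)" for X
  define T where "T = PiE ({..<p} \<times> {..<k}) (\<lambda>_. {- int M..int M})"
  obtain N where N: "N \<subseteq> S" and rep: "\<And>x. x \<in> S \<Longrightarrow> \<exists>y\<in>N. g y = g x" and inj: "inj_on g N"
    using representatives[of S g] by metis
  have "g ` N \<subseteq> T"
  proof (rule image_subsetI)
    fix X assume "X \<in> N"
    then have X: "X \<in> S" using N by auto
    have "\<lfloor>B X i j / \<delta>\<rfloor> \<in> {- int M..int M}" if "i < p" "j < k" for i j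
    proof -
      have "\<bar>B X i j / \<delta>\<bar> \<le> sqrt R / \<delta>"
        using B[OF X that] \<delta> by (simp add: divide_right_mono)
      also have "\<dots> = 2 * (real p)\<^sup>2 * R / \<epsilon>" using R \<epsilon> p by (simp add: \<delta>_def field_simps)
      also note M
      finally have "\<bar>B X i j / \<delta>\<bar> \<le> real M" .
      then have "real_of_int (- int M) \<le> B X i j / \<delta>" "B X i j / \<delta> < real_of_int (int M) + 1"
        unfolding abs_le_iff by simp_all
      then show ?thesis by (simp only: atLeastAtMost_iff floor_le_iff le_floor_iff simp_thms)
    qed
    then show "g X \<in> T" by (auto simp: g_def T_def)
  qed
  moreover have "finite T" by (auto simp: T_def intro!: finite_PiE)
  ultimately have fin: "finite N" and card: "card N \<le> card T"
    using inj by (auto dest: inj_on_finite card_inj_on_le)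
  have "card T = (2 * M + 1) ^ (p * k)"
  proof -
    have "card {- int M..int M} = 2 * M + 1" by (simp add: nat_eq_iff)
    then show ?thesis by (simp only: T_def card_PiE finite_SigmaI finite_lessThan prod_constant
          card_cartesian_product card_lessThan)
  qed
  moreover have "\<exists>Y\<in>N. frob (X - Y) \<le> \<epsilon>" if X: "X \<in> S" for X
  proof -
    obtain Y where YN: "Y \<in> N" and eq: "g Y = g X" using rep[OF X] by blast
    have Y: "Y \<in> S" using YN N by auto
    have cell: "\<bar>B X i j - B Y i j\<bar> \<le> \<delta>" if "i < p" "j < k" for i j
      using fun_cong[OF eq, of "(i, j)"] that \<delta> by (intro floor_eq_imp_diff_le) (auto simp: g_def)
    have "frob (X - Y) \<le> real p * (2 * real p * sqrt R * \<delta>)"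
    proof (rule frob_le)
      show "X - Y \<in> carrier_mat p p" using X Y by (auto simp: S_def dest!: Sp_carrier)
      fix i l assume il: "i < p" "l < p"
      have "(X - Y) $$ (i, l) = X $$ (i, l) - Y $$ (i, l)"
        using X Y il by (auto simp: S_def dest!: Sp_carrier)
      \<comment> \<open>The product difference is split by changing one factor at a time, which
        gives 2 sqrt R \<delta> per summand.\<close>
      also have "\<dots> = (\<Sum>j<k. B X i j * (B X l j - B Y l j) + (B X i j - B Y i j) * B Y l j)"
        unfolding XB[OF X il] XB[OF Y il] by (simp add: algebra_simps flip: sum_subtractf)
      also have "\<bar>\<dots>\<bar> \<le> (\<Sum>j<k. sqrt R * \<delta> + \<delta> * sqrt R)"
      proof (rule order_trans[OF sum_abs sum_mono])
        fix j assume "j \<in> {..<k}"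
        then have j: "j < k" by simp
        have "\<bar>B X i j * (B X l j - B Y l j)\<bar> \<le> sqrt R * \<delta>"
          unfolding abs_mult using B[OF X il(1) j] cell[OF il(2) j] R by (intro mult_mono) auto
        moreover have "\<bar>(B X i j - B Y i j) * B Y l j\<bar> \<le> \<delta> * sqrt R"
          unfolding abs_mult using B[OF Y il(2) j] cell[OF il(1) j] \<delta> by (intro mult_mono) auto
        ultimately show "\<bar>B X i j * (B X l j - B Y l j) + (B X i j - B Y i j) * B Y l j\<bar> \<le> sqrt R * \<delta> + \<delta> * sqrt R"
          by linarith
      qed
      also have "\<dots> = real k * (2 * sqrt R * \<delta>)" by simp
      also have "\<dots> \<le> real p * (2 * sqrt R * \<delta>)" using k \<delta> R by (intro mult_right_mono) auto
      finally show "\<bar>(X - Y) $$ (i, l)\<bar> \<le> 2 * real p * sqrt R * \<delta>" by simp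
    qed (use \<delta> R in auto)
    also have "\<dots> = \<epsilon>" using p R by (simp add: \<delta>_def power2_eq_square)
    finally show ?thesis using YN by blast
  qed
  ultimately show ?thesis using fin card N by (intro exI[of _ N]) (auto simp: S_def)
qed

text \<open>Supplies a countable set of fixed matrices over which the almost sure bounds of A4 can
  be intersected. Cell representatives keep this set inside the cone.\<close>

lemma Sp_separable:
  "\<exists>D. countable D \<and> D \<subseteq> Sp p \<and> (\<forall>X\<in>Sp p. \<forall>\<eta>>0. \<exists>Y\<in>D. frob (X - Y) < \<eta>)"
proof -
  define g where "g m X = (\<lambda>ij\<in>{..<p} \<times> {..<p}. \<lfloor>X $$ ij / (1 / real (Suc m))\<rfloor>)" for m :: nat and X :: "real mat"
  have "\<exists>N. N \<subseteq> Sp p \<and> (\<forall>x\<in>Sp p. \<exists>y\<in>N. g m y = g m x) \<and> inj_on (g m) N" for m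
    using representatives[of "Sp p" "g m"] by metis
  then obtain N where N: "\<And>m. N m \<subseteq> Sp p" "\<And>m x. x \<in> Sp p \<Longrightarrow> \<exists>y\<in>N m. g m y = g m x"
    "\<And>m. inj_on (g m) (N m)" by metis
  have "countable (N m)" for m
  proof -
    have "countable (PiE ({..<p} \<times> {..<p}) (\<lambda>_. UNIV :: int set))" by (intro countable_PiE) auto
    then have "countable (g m ` N m)" by (rule countable_subset[rotated])
        (simp only: image_subset_iff g_def restrict_PiE_iff UNIV_I ball_triv simp_thms)
    then show ?thesis using N(3) by (rule countable_image_inj_on)
  qed
  moreover have "\<exists>Y\<in>(\<Union>m. N m). frob (X - Y) < \<eta>" if X: "X \<in> Sp p" and \<eta>: "\<eta> > 0" for X \<eta>
  proof -
    obtain m where m: "real p / \<eta> < real m" using reals_Archimedean2 by blast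
    obtain Y where Y: "Y \<in> N m" "g m Y = g m X" using N(2)[OF X] by blast
    have c: "X \<in> carrier_mat p p" "Y \<in> carrier_mat p p" using X Y N(1) by (auto intro: Sp_carrier)
    have "frob (X - Y) \<le> real p * (1 / real (Suc m))"
    proof (rule frob_le)
      fix i l assume "i < p" "l < p"
      then show "\<bar>(X - Y) $$ (i, l)\<bar> \<le> 1 / real (Suc m)"
        using c fun_cong[OF Y(2), of "(i, l)"] floor_eq_imp_diff_le[of "1 / real (Suc m)" "X $$ (i, l)" "Y $$ (i, l)"]
        by (simp add: g_def)
    qed (use c in auto)
    also have "\<dots> < \<eta>" using m \<eta> by (simp add: field_simps)
    finally show ?thesis using Y by blast
  qed
  moreover have "(\<Union>m. N m) \<subseteq> Sp p" using N(1) by (rule UN_least)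
  ultimately show ?thesis by (intro exI[of _ "\<Union>m. N m"]) auto
qed

section \<open>Concentration\<close>

text \<open>A bound on an infimum does not directly give a moment at the level KC. Doubling the
  level makes the inequality strict, so some admissible t lies below 2 KC, and the moment decreases
  in the level.\<close>

lemma psi1_imp_exp_moment:
  assumes "psi1 M Y \<le> ennreal KC" "KC > 0"
  shows "(\<integral>\<^sup>+ x. ennreal (exp (\<bar>Y x\<bar> / (2 * KC))) \<partial>M) \<le> 2"
proof -
  have "psi1 M Y < ennreal (2 * KC)"
    using assms by (intro order.strict_trans1[OF assms(1)]) (simp add: ennreal_less_iff)
  then obtain t where t: "t > 0" "ennreal t < ennreal (2 * KC)"
    "(\<integral>\<^sup>+ x. ennreal (exp (\<bar>Y x\<bar> / t)) \<partial>M) \<le> 2"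
    unfolding psi1_def Inf_less_iff by auto
  have "t \<le> 2 * KC" using t(1,2) assms(2) by (simp add: ennreal_less_iff)
  then have "(\<integral>\<^sup>+ x. ennreal (exp (\<bar>Y x\<bar> / (2 * KC))) \<partial>M) \<le> (\<integral>\<^sup>+ x. ennreal (exp (\<bar>Y x\<bar> / t)) \<partial>M)"
    using t(1) by (intro nn_integral_mono ennreal_leI) (simp add: divide_left_mono)
  with t(3) show ?thesis by simp
qed

locale sample_problem =
  fixes p n :: nat and \<mu> :: "(nat \<Rightarrow> real) measure"
    and f :: "real mat \<Rightarrow> (nat \<Rightarrow> real) \<Rightarrow> real" and R K c :: real
    and C :: "(nat \<Rightarrow> real) \<Rightarrow> real" and Cmu KC :: real
  assumes p: "p \<ge> 1" and n: "n \<ge> 1" and K: "K \<ge> 1" and R: "R \<ge> 1" and Cmu: "Cmu \<ge> 1" and KC: "KC \<ge> 1"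
    and c: "c > 0"
    and prob: "prob_space \<mu>"
    and integrable_f: "\<And>X. X \<in> Sp p \<Longrightarrow> integrable \<mu> (f X)"
    and bern: "bernstein p n \<mu> f R K c"
    and lip: "A4 p \<mu> f C Cmu KC"
begin

abbreviation "P \<equiv> sampleM n \<mu>"

sublocale \<mu>: prob_space \<mu> by (rule prob)

lemma prob_P: "prob_space P"
  unfolding sampleM_def by (rule prob_space_PiM) (rule prob)

sublocale P: prob_space P by (rule prob_P)

lemma component_measurable:
  assumes "h \<in> borel_measurable \<mu>" "i < n"
  shows "(\<lambda>zs. h (zs i)) \<in> borel_measurable P"
  using assms measurable_compose[OF measurable_component_singleton[of i "{..<n}" "\<lambda>_. \<mu>"] assms(1)]
  by (simp add: sampleM_def)

lemma Fn_measurable: "X \<in> Sp p \<Longrightarrow> (\<lambda>zs. Fn f n X zs) \<in> borel_measurable P"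
  unfolding Fn_def using integrable_f
  by (intro borel_measurable_divide borel_measurable_sum component_measurable[of "f X"]) auto

lemma C_measurable: "C \<in> borel_measurable \<mu>"
  using lip by (simp add: A4_def)

lemma C_integrable: "integrable \<mu> C"
proof (rule integrableI_bounded)
  show "(\<integral>\<^sup>+ z. ennreal (norm (C z)) \<partial>\<mu>) < \<infinity>"
    using lip by (auto simp: A4_def intro: le_less_trans)
qed (rule C_measurable)

lemma C_mean: "(\<integral>z. C z \<partial>\<mu>) \<le> Cmu"
proof -
  have "(\<integral>z. C z \<partial>\<mu>) \<le> (\<integral>z. \<bar>C z\<bar> \<partial>\<mu>)"
    using C_integrable by (intro integral_mono) auto
  also have "ennreal (\<integral>z. \<bar>C z\<bar> \<partial>\<mu>) = (\<integral>\<^sup>+ z. ennreal \<bar>C z\<bar> \<partial>\<mu>)"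
    using C_integrable by (intro nn_integral_eq_integral[symmetric]) auto
  then have "ennreal (\<integral>z. \<bar>C z\<bar> \<partial>\<mu>) \<le> ennreal Cmu"
    using lip by (simp add: A4_def)
  then have "(\<integral>z. \<bar>C z\<bar> \<partial>\<mu>) \<le> Cmu" using Cmu by (subst (asm) ennreal_le_iff) auto
  finally show ?thesis .
qed

definition Cbar :: "(nat \<Rightarrow> nat \<Rightarrow> real) \<Rightarrow> real" where
  "Cbar zs = (\<Sum>i<n. C (zs i)) / real n"

lemma Cbar_measurable: "Cbar \<in> borel_measurable P"
  unfolding Cbar_def[abs_def] using C_measurable
  by (intro borel_measurable_divide borel_measurable_sum component_measurable[of C]) auto

lemma EF_lipschitz:
  assumes X: "X \<in> Sp p" and Y: "Y \<in> Sp p"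
  shows "EF \<mu> f X - EF \<mu> f Y \<le> Cmu * frob (X - Y)"
proof -
  have "EF \<mu> f X - EF \<mu> f Y = (\<integral>z. f X z - f Y z \<partial>\<mu>)"
    unfolding EF_def using integrable_f X Y by simp
  also have "\<dots> \<le> (\<integral>z. C z * frob (X - Y) \<partial>\<mu>)"
  proof (rule integral_mono_AE)
    have "AE z in \<mu>. \<bar>f X z - f Y z\<bar> \<le> C z * frob (X - Y)"
      using lip X Y by (simp add: A4_def)
    then show "AE z in \<mu>. f X z - f Y z \<le> C z * frob (X - Y)"
      by eventually_elim simp
  qed (use integrable_f X Y C_integrable in auto)
  also have "\<dots> = (\<integral>z. C z \<partial>\<mu>) * frob (X - Y)" by simp
  also have "\<dots> \<le> Cmu * frob (X - Y)" using C_mean by (intro mult_right_mono) auto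
  finally show ?thesis .
qed

lemma AE_component:
  assumes "AE z in \<mu>. Q z"
  shows "AE zs in P. \<forall>i<n. Q (zs i)"
proof -
  have "AE zs in P. \<forall>i\<in>{..<n}. Q (zs i)"
    unfolding sampleM_def using assms prob
    by (subst AE_ball_countable) (auto intro!: AE_PiM_component)
  then show ?thesis unfolding Ball_def lessThan_iff .
qed

lemma AE_Fn_lipschitz:
  assumes X: "X \<in> Sp p" and Y: "Y \<in> Sp p"
  shows "AE zs in P. \<bar>Fn f n X zs - Fn f n Y zs\<bar> \<le> Cbar zs * frob (X - Y)"
proof -
  have "AE z in \<mu>. \<bar>f X z - f Y z\<bar> \<le> C z * frob (X - Y)"
    using lip X Y by (simp add: A4_def)
  from AE_component[OF this] show ?thesis
  proof eventually_elim
    case (elim zs)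
    have "\<bar>Fn f n X zs - Fn f n Y zs\<bar> = \<bar>\<Sum>i<n. f X (zs i) - f Y (zs i)\<bar> / real n"
      by (simp add: Fn_def sum_subtractf flip: diff_divide_distrib)
    also have "\<dots> \<le> (\<Sum>i<n. C (zs i) * frob (X - Y)) / real n"
      using elim by (intro divide_right_mono order_trans[OF sum_abs sum_mono]) auto
    finally show ?case by (simp add: Cbar_def sum_distrib_right)
  qed
qed

text \<open>Chernoff's bound with exponential moment 2 per coordinate gives e^(-n) 2^n. The stated
  decay rate 1/4 originates here.\<close>

lemma Cbar_tail: "measure P {zs \<in> space P. Cbar zs > Cmu + 2 * KC} \<le> exp (- (1/4) * real n)"
proof -
  let ?E = "\<integral>z. C z \<partial>\<mu>"
  let ?A = "{zs \<in> space P. Cbar zs > Cmu + 2 * KC}"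
  let ?g = "\<lambda>z. ennreal (exp (\<bar>C z - ?E\<bar> / (2 * KC)))"
  interpret product_sigma_finite "\<lambda>_::nat. \<mu>" by standard
  have A: "?A \<in> sets P" using Cbar_measurable by measurable
  have gm: "?g \<in> borel_measurable \<mu>" using C_measurable by measurable
  have "emeasure P ?A = (\<integral>\<^sup>+ zs. indicator ?A zs \<partial>P)" using A by simp
  also have "\<dots> \<le> (\<integral>\<^sup>+ zs. ennreal (exp (- real n)) * (\<Prod>i<n. ?g (zs i)) \<partial>P)"
  proof (rule nn_integral_mono)
    fix zs
    show "indicator ?A zs \<le> ennreal (exp (- real n)) * (\<Prod>i<n. ?g (zs i))"
    proof (cases "zs \<in> ?A")
      case True
      then have "(Cmu + 2 * KC) * real n < (\<Sum>i<n. C (zs i))"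
        using n by (simp add: Cbar_def pos_less_divide_eq)
      \<comment> \<open>The mean is at most Cmu, so on the event the centred sum is at least 2 KC n;
        dividing by 2 KC matches the level of the exponential moment.\<close>
      then have "2 * KC * real n \<le> (\<Sum>i<n. C (zs i)) - real n * ?E"
        using mult_left_mono[OF C_mean, of "real n"] by (simp add: algebra_simps)
      also have "\<dots> = (\<Sum>i<n. C (zs i) - ?E)" by (simp add: sum_subtractf)
      also have "\<dots> \<le> (\<Sum>i<n. \<bar>C (zs i) - ?E\<bar>)" by (intro sum_mono) auto
      finally have "real n \<le> (\<Sum>i<n. \<bar>C (zs i) - ?E\<bar>) / (2 * KC)"
        using KC by (simp add: pos_le_divide_eq mult.commute)
      then have "1 \<le> exp (- real n + (\<Sum>i<n. \<bar>C (zs i) - ?E\<bar> / (2 * KC)))"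
        by (simp add: sum_divide_distrib)
      also have "\<dots> = exp (- real n) * (\<Prod>i<n. exp (\<bar>C (zs i) - ?E\<bar> / (2 * KC)))"
        by (subst exp_add) (simp add: exp_sum)
      finally have "ennreal 1 \<le> ennreal (exp (- real n) * (\<Prod>i<n. exp (\<bar>C (zs i) - ?E\<bar> / (2 * KC))))"
        by (rule ennreal_leI)
      then show ?thesis using True by (simp add: ennreal_mult prod_ennreal prod_nonneg)
    qed simp
  qed
  also have "\<dots> = ennreal (exp (- real n)) * (\<integral>\<^sup>+ zs. (\<Prod>i<n. ?g (zs i)) \<partial>P)"
  proof (rule nn_integral_cmult)
    show "(\<lambda>zs. \<Prod>i<n. ?g (zs i)) \<in> borel_measurable P"
      unfolding sampleM_def using gm by measurable
  qed
  also have "(\<integral>\<^sup>+ zs. (\<Prod>i<n. ?g (zs i)) \<partial>P) = (\<Prod>i<n. \<integral>\<^sup>+ z. ?g z \<partial>\<mu>)"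
    unfolding sampleM_def using gm by (intro product_nn_integral_prod) auto
  also have "\<dots> \<le> (\<Prod>i<n. 2)"
    using lip KC by (intro prod_mono_ennreal psi1_imp_exp_moment) (auto simp: A4_def)
  also have "\<dots> = ennreal (2 ^ n)" by (simp flip: ennreal_power)
  also have "ennreal (exp (- real n)) * ennreal (2 ^ n) = ennreal (exp (- real n) * 2 ^ n)"
    by (simp add: ennreal_mult)
  finally have "emeasure P ?A \<le> ennreal (exp (- real n) * 2 ^ n)" by (simp add: mult_left_mono)
  then have "measure P ?A \<le> exp (- real n) * 2 ^ n"
    by (simp add: P.emeasure_eq_measure)
  also have "\<dots> \<le> exp (- real n) * exp (3/4) ^ n"
  proof (intro mult_left_mono power_mono)
    \<comment> \<open>1 + 3/4 + 9/32 = 65/32, just above 2.\<close>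
    have "2 \<le> 1 + 3/4 + (3/4)\<^sup>2 / (2::real)" by (simp add: power2_eq_square)
    also have "\<dots> \<le> exp (3/4)" by (rule exp_lower_Taylor_quadratic) simp
    finally show "2 \<le> exp (3/4 :: real)" .
  qed auto
  also have "\<dots> = exp (- (1/4) * real n)"
    by (simp flip: exp_of_nat_mult exp_add)
  finally show ?thesis .
qed

text \<open>Bernstein's inequality with equal weights 1/n, whose Euclidean norm is 1/sqrt n and
  whose maximum is 1/n.\<close>

lemma Fn_deviation:
  assumes X: "X \<in> Sp p" "sigma_max X \<le> R" and t: "t \<ge> 0"
  shows "measure P {zs \<in> space P. \<bar>Fn f n X zs - EF \<mu> f X\<bar> > K * (sqrt (t / real n) + t / real n)} \<le> 2 * exp (- c * t)"
proof -
  let ?a = "\<lambda>i::nat. 1 / real n"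
  have 1: "(\<Sum>i<n. ?a i * (f X (zs i) - EF \<mu> f X)) = Fn f n X zs - EF \<mu> f X" for zs
    unfolding sum_distrib_left[symmetric] sum_subtractf using n by (simp add: Fn_def diff_divide_distrib)
  have 2: "sqrt (\<Sum>i<n. (?a i)\<^sup>2) * sqrt t = sqrt (t / real n)"
    using n by (simp add: power2_eq_square flip: real_sqrt_mult)
  have "(\<lambda>i. \<bar>?a i\<bar>) ` {..<n} = {1 / real n}"
    using n by (auto simp: image_constant_conv lessThan_empty_iff)
  then have 3: "Max ((\<lambda>i. \<bar>?a i\<bar>) ` {..<n}) * t = t / real n" by simp
  have "measure P {zs \<in> space P. \<bar>\<Sum>i<n. ?a i * (f X (zs i) - EF \<mu> f X)\<bar>
      > K * (sqrt (\<Sum>i<n. (?a i)\<^sup>2) * sqrt t + Max ((\<lambda>i. \<bar>?a i\<bar>) ` {..<n}) * t)} \<le> 2 * exp (- c * t)"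
    by (rule bern[unfolded bernstein_def, rule_format, OF X t, where a = ?a])
  then show ?thesis unfolding 1 2 3 .
qed

end

section \<open>Choice of scales, entropy of the nets and uniform deviation\<close>

context sample_problem
begin

definition y :: real where "y = ((2 * real p + 1) / real n) powr (1/3)"

definition L :: real where "L = ln (real n powr (1/3) * real p) + ln (18 * R * (KC + Cmu))"

lemma y_pos: "y > 0"
  using n by (simp add: y_def)

lemma y_cube: "real n * y ^ 3 = 2 * real p + 1"
proof -
  have "y ^ 3 = y powr 3" using y_pos by (simp add: powr_numeral)
  also have "\<dots> = (2 * real p + 1) / real n" using n by (simp add: y_def powr_powr)
  finally show ?thesis using n by simp
qed

lemma y_square: "y\<^sup>2 = (2 * real p + 1) powr (2/3) / real n powr (2/3)"
proof -
  have "y\<^sup>2 = y powr 2" using y_pos by (simp add: powr_numeral)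
  also have "\<dots> = ((2 * real p + 1) / real n) powr (2/3)" by (simp add: y_def powr_powr)
  finally show ?thesis by (simp add: powr_divide)
qed

lemma n_y_square: "real n * y\<^sup>2 = (2 * real p + 1) powr (2/3) * real n powr (1/3)"
proof -
  have "real n = real n powr (2/3) * real n powr (1/3)" using n by (simp flip: powr_add)
  then show ?thesis unfolding y_square using n by (simp add: field_simps)
qed

lemma y_ge: "1 / real n powr (1/3) \<le> y"
proof -
  have "1 powr (1/3) \<le> (2 * real p + 1) powr (1/3)" by (intro powr_mono2) auto
  then show ?thesis using n by (simp add: y_def powr_divide divide_right_mono)
qed

lemma exp_L: "exp L = real n powr (1/3) * real p * (18 * R * (KC + Cmu))"
  using n p R KC Cmu by (simp add: L_def exp_add)

lemma n_powr_ge: "real n powr (1/3) \<ge> 1"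
  using n by (intro ge_one_powr_ge_zero) auto

lemma scale_ge: "R * (KC + Cmu) * real n powr (1/3) \<ge> 2"
proof -
  have "1 * 2 * 1 \<le> R * (KC + Cmu) * real n powr (1/3)"
    using R KC Cmu n_powr_ge by (intro mult_mono) auto
  then show ?thesis by simp
qed

lemma exp_L_ge: "exp L \<ge> 36"
proof -
  have "18 * (2 * 1) \<le> 18 * (R * (KC + Cmu) * real n powr (1/3) * real p)"
    using scale_ge p by (intro mult_left_mono mult_mono) auto
  then show ?thesis by (simp add: exp_L algebra_simps)
qed

lemma L_ge: "L \<ge> 1"
proof -
  have "exp 1 \<le> exp L" using exp_L_ge exp_le by linarith
  then show ?thesis by simp
qed

text \<open>The Bernstein level for rank k. After multiplication by c the first term is k(2p+1)L:
  2pkL pays for the net and kL for the sum over ranks. The second term, free of k, yields the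
  exponent of the stated probability.\<close>

definition t :: "nat \<Rightarrow> real" where "t k = real k * (2 * real p + 1) * L / c + 2 * real n * y\<^sup>2"

lemma t_nonneg: "t k \<ge> 0"
  using L_ge c by (simp add: t_def)

lemma t_div_n: "t k / real n = (real k * L * y\<^sup>2 / c) * y + 2 * y\<^sup>2"
  using n c by (simp add: t_def flip: y_cube) (simp add: field_simps power2_eq_square power3_eq_cube)

lemma deviation_bound:
  assumes "y \<le> 1"
  shows "sqrt (t k / real n) + t k / real n \<le> 3/2 * (real k * L * y\<^sup>2 / c) + 4 * y"
proof -
  define x where "x = real k * L * y\<^sup>2 / c"
  have x: "x \<ge> 0" using L_ge c by (simp add: x_def)
  \<comment> \<open>The square on the right is x^2/4 + 2xy + 4y^2. The root therefore contributes
    x/2 + 2y, and y \<le> 1 bounds the linear term by x + 2y.\<close>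
  have "x * y + 2 * y\<^sup>2 \<le> (x / 2 + 2 * y)\<^sup>2"
    using x y_pos by (simp add: power2_eq_square algebra_simps)
  then have "sqrt (x * y + 2 * y\<^sup>2) \<le> x / 2 + 2 * y"
    using x y_pos by (intro real_le_lsqrt) auto
  moreover have "x * y \<le> x * 1" by (rule mult_left_mono[OF assms x])
  moreover have "2 * y * y \<le> 2 * y * 1" using assms y_pos by (intro mult_left_mono) auto
  ultimately have "sqrt (x * y + 2 * y\<^sup>2) + (x * y + 2 * y\<^sup>2) \<le> 3/2 * x + 4 * y"
    by (simp add: power2_eq_square)
  then show ?thesis unfolding t_div_n x_def .
qed

text \<open>Chosen so that (2 Cmu + 2 KC) \<epsilon> = n^(-1/3) \<le> y. The factor adds the
  Lipschitz constant Cmu of the expected risk to the high-probability constant Cmu + 2 KC of the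
  empirical one.\<close>

definition \<epsilon> :: real where "\<epsilon> = 1 / (2 * (KC + Cmu) * real n powr (1/3))"

lemma eps_pos: "\<epsilon> > 0"
  using KC Cmu n by (auto simp: \<epsilon>_def)

lemma lipschitz_eps: "(2 * Cmu + 2 * KC) * \<epsilon> \<le> K * y"
proof -
  define w where "w = 2 * (KC + Cmu)"
  have eps: "\<epsilon> = 1 / (w * real n powr (1/3))" by (simp only: \<epsilon>_def w_def)
  have "w > 0" using KC Cmu by (simp add: w_def)
  moreover have "2 * Cmu + 2 * KC = w" by (simp add: w_def)
  ultimately have "(2 * Cmu + 2 * KC) * \<epsilon> = 1 / real n powr (1/3)"
    using eps by simp
  also have "\<dots> \<le> 1 * y" using y_ge by simp
  also have "\<dots> \<le> K * y" using K y_pos by (intro mult_right_mono) auto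
  finally show ?thesis .
qed

text \<open>With v = e^L / 18 one has p \<le> v and 2 p^2 R / \<epsilon> = 4 v p, hence 2M+1 \<le> 8
  v^2 + 3 \<le> 324 v^2 = e^(2L): the logarithmic factor L measures the number of cells per
  coordinate.\<close>

lemma net:
  "\<exists>N. (\<forall>k\<le>p. finite (N k) \<and> N k \<subseteq> {X \<in> Sp p. sigma_max X \<le> R} \<and>
      real (card (N k)) \<le> exp (2 * L) ^ (p * k)) \<and>
    (\<forall>X\<in>Sp p. sigma_max X \<le> R \<longrightarrow> (\<exists>Y\<in>N (nz p X). frob (X - Y) \<le> \<epsilon>))"
proof -
  define M where "M = nat \<lceil>2 * (real p)\<^sup>2 * R / \<epsilon>\<rceil>"
  have M: "2 * (real p)\<^sup>2 * R / \<epsilon> \<le> real M" by (simp add: M_def real_nat_ceiling_ge)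
  define v where "v = R * (KC + Cmu) * real n powr (1/3) * real p"
  have v: "v \<ge> 2"
  proof -
    have "2 * 1 \<le> v" unfolding v_def using scale_ge p by (intro mult_mono) auto
    then show ?thesis by simp
  qed
  have "real M \<le> 2 * (real p)\<^sup>2 * R / \<epsilon> + 1"
    using eps_pos R by (simp add: M_def)
  also have "2 * (real p)\<^sup>2 * R / \<epsilon> = 4 * (v * real p)"
    using KC Cmu n by (simp add: \<epsilon>_def v_def power2_eq_square)
  also have "v * real p \<le> v * v"
  proof (rule mult_left_mono)
    have "1 * real p \<le> v" unfolding v_def using scale_ge by (intro mult_right_mono) auto
    then show "real p \<le> v" by simp
  qed (use v in auto)
  finally have "real (2 * M + 1) \<le> 8 * (v * v) + 3" by simp
  also have "\<dots> \<le> 324 * (v * v)" using mult_mono[of 2 v 2 v] v by simp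
  also have "\<dots> = exp L * exp L" by (simp add: exp_L v_def)
  finally have M2: "real (2 * M + 1) \<le> exp (2 * L)" by (simp flip: exp_add)
  \<comment> \<open>The guard k \<le> p sits under the existential so that choice applies to every
    k.\<close>
  have "\<forall>k. \<exists>N. k \<le> p \<longrightarrow> finite N \<and> N \<subseteq> {X \<in> Sp p. sigma_max X \<le> R} \<and> card N \<le> (2 * M + 1) ^ (p * k) \<and>
    (\<forall>X\<in>Sp p. sigma_max X \<le> R \<longrightarrow> nz p X = k \<longrightarrow> (\<exists>Y\<in>N. frob (X - Y) \<le> \<epsilon>))"
    (is "\<forall>k. \<exists>N. ?Q k N")
  proof
    fix k
    show "\<exists>N. ?Q k N"
    proof (cases "k \<le> p")
      case True
      from low_rank_net[OF p R eps_pos True M] show ?thesis by (simp only: True simp_thms)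
    qed simp
  qed
  from choice[OF this] obtain N where
    "\<forall>k. k \<le> p \<longrightarrow> finite (N k) \<and> N k \<subseteq> {X \<in> Sp p. sigma_max X \<le> R} \<and> card (N k) \<le> (2 * M + 1) ^ (p * k) \<and>
    (\<forall>X\<in>Sp p. sigma_max X \<le> R \<longrightarrow> nz p X = k \<longrightarrow> (\<exists>Y\<in>N k. frob (X - Y) \<le> \<epsilon>))"
    by (rule exE)
  then have N: "\<And>k. k \<le> p \<Longrightarrow> finite (N k)" "\<And>k. k \<le> p \<Longrightarrow> N k \<subseteq> {X \<in> Sp p. sigma_max X \<le> R}"
    "\<And>k. k \<le> p \<Longrightarrow> card (N k) \<le> (2 * M + 1) ^ (p * k)"
    "\<And>k X. k \<le> p \<Longrightarrow> X \<in> Sp p \<Longrightarrow> sigma_max X \<le> R \<Longrightarrow> nz p X = k \<Longrightarrow> \<exists>Y\<in>N k. frob (X - Y) \<le> \<epsilon>"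
    by simp_all
  have "real (card (N k)) \<le> exp (2 * L) ^ (p * k)" if "k \<le> p" for k
  proof -
    have "real (card (N k)) \<le> real (2 * M + 1) ^ (p * k)"
      using N(3)[OF that] by (simp only: of_nat_power[symmetric] of_nat_le_iff)
    also have "\<dots> \<le> exp (2 * L) ^ (p * k)" using M2 by (intro power_mono) auto
    finally show ?thesis .
  qed
  then show ?thesis using N(1,2,4) nz_le by (intro exI[of _ N]) auto
qed

text \<open>The regularity that the uniform bound asks of a data-dependent matrix; stationarity
  supplies it.\<close>

definition cont_at :: "(nat \<Rightarrow> nat \<Rightarrow> real) \<Rightarrow> real mat \<Rightarrow> bool" where
  "cont_at zs X \<longleftrightarrow> (\<forall>\<eta>>0. \<exists>\<delta>>0. \<forall>Y\<in>Sp p. frob (Y - X) < \<delta> \<longrightarrow> \<bar>Fn f n Y zs - Fn f n X zs\<bar> \<le> \<eta>)"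

text \<open>A double union bound: level k fails with probability at most 2 q e^(-Lk), where q is the
  exponential on the right. Since e^L \<ge> 36, a geometric series of ratio 1/2 dominates and the
  total is 4 q.\<close>

lemma net_failure:
  assumes N: "\<And>k. k \<le> p \<Longrightarrow> finite (N k)" "\<And>k. k \<le> p \<Longrightarrow> N k \<subseteq> {X \<in> Sp p. sigma_max X \<le> R}"
    "\<And>k. k \<le> p \<Longrightarrow> real (card (N k)) \<le> exp (2 * L) ^ (p * k)"
  defines "bad \<equiv> \<lambda>k X. {zs \<in> space P. \<bar>Fn f n X zs - EF \<mu> f X\<bar> > K * (sqrt (t k / real n) + t k / real n)}"
  shows "measure P (\<Union>k\<in>{..p}. \<Union>X\<in>N k. bad k X) \<le> 4 * exp (- c * (2 * real n * y\<^sup>2))"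
proof -
  have bad_sets: "bad k X \<in> sets P" if "k \<le> p" "X \<in> N k" for k X
  proof -
    have [measurable]: "(\<lambda>zs. Fn f n X zs) \<in> borel_measurable P" using Fn_measurable N(2) that by blast
    show ?thesis unfolding bad_def by measurable
  qed
  have level: "measure P (\<Union>X\<in>N k. bad k X) \<le> 2 * exp (- c * (2 * real n * y\<^sup>2)) * (1/2) ^ k" if k: "k \<le> p" for k
  proof -
    have "measure P (\<Union>X\<in>N k. bad k X) \<le> (\<Sum>X\<in>N k. measure P (bad k X))"
      using N(1)[OF k] bad_sets[OF k] by (intro P.finite_measure_subadditive_finite) auto
    also have "\<dots> \<le> (\<Sum>X\<in>N k. 2 * exp (- c * t k))"
      using N(2)[OF k] unfolding bad_def by (intro sum_mono Fn_deviation t_nonneg) auto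
    also have "\<dots> = real (card (N k)) * (2 * exp (- c * t k))" by simp
    also have "\<dots> \<le> exp (2 * L) ^ (p * k) * (2 * exp (- c * t k))"
      using N(3)[OF k] by (intro mult_right_mono) auto
    also have "\<dots> = 2 * exp (- c * (2 * real n * y\<^sup>2)) * exp (- L) ^ k"
    proof -
      \<comment> \<open>The net contributes 2pkL, which leaves -kL of the first part of -c
        \<open>t k\<close>.\<close>
      have "real (p * k) * (2 * L) + - c * t k = - c * (2 * real n * y\<^sup>2) + real k * (- L)"
        using c by (simp add: t_def field_simps)
      then have "exp (2 * L) ^ (p * k) * exp (- c * t k) = exp (- c * (2 * real n * y\<^sup>2)) * exp (- L) ^ k"
        by (simp only: exp_of_nat_mult[symmetric] exp_add[symmetric])
      then show ?thesis by (simp only: mult_ac)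
    qed
    also have "\<dots> \<le> 2 * exp (- c * (2 * real n * y\<^sup>2)) * (1/2) ^ k"
    proof (intro mult_left_mono power_mono)
      have "inverse (exp L) \<le> inverse 2" using exp_L_ge by (intro le_imp_inverse_le) auto
      then show "exp (- L) \<le> 1/2" by (simp add: exp_minus)
    qed auto
    finally show ?thesis .
  qed
  have "measure P (\<Union>k\<in>{..p}. \<Union>X\<in>N k. bad k X) \<le> (\<Sum>k\<le>p. measure P (\<Union>X\<in>N k. bad k X))"
    using bad_sets N(1) by (intro P.finite_measure_subadditive_finite) (auto intro!: sets.finite_UN)
  also have "\<dots> \<le> (\<Sum>k\<le>p. 2 * exp (- c * (2 * real n * y\<^sup>2)) * (1/2) ^ k)"
    using level by (intro sum_mono) auto
  also have "\<dots> = 2 * exp (- c * (2 * real n * y\<^sup>2)) * (\<Sum>k\<le>p. (1/2) ^ k)" by (simp only: sum_distrib_left)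
  also have "\<dots> \<le> 2 * exp (- c * (2 * real n * y\<^sup>2)) * 2"
    by (intro mult_left_mono) (auto simp: sum_gp0)
  finally show ?thesis by simp
qed

text \<open>Assumption A4 only holds almost surely for each fixed pair of matrices, so the empirical risk
  need not be Lipschitz at a data-dependent matrix. It is Lipschitz on a countable dense set,
  and continuity at the matrix in question transfers the estimate.\<close>
lemma lipschitz_extends:
  assumes D: "D \<subseteq> Sp p" "\<forall>X\<in>Sp p. \<forall>\<eta>>0. \<exists>Y\<in>D. frob (X - Y) < \<eta>"
    and X: "X \<in> Sp p" and Y: "Y \<in> Sp p" and cont: "cont_at zs X"
    and lip: "\<And>W. W \<in> D \<Longrightarrow> \<bar>Fn f n W zs - Fn f n Y zs\<bar> \<le> B * frob (W - Y)" and B: "B \<ge> 0"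
  shows "Fn f n Y zs - Fn f n X zs \<le> B * frob (X - Y)"
proof (rule field_le_epsilon)
  fix e :: real assume e: "e > 0"
  obtain \<delta> where \<delta>: "\<delta> > 0" "\<And>W. W \<in> Sp p \<Longrightarrow> frob (W - X) < \<delta> \<Longrightarrow> \<bar>Fn f n W zs - Fn f n X zs\<bar> \<le> e / 2"
    using cont e unfolding cont_at_def by (meson half_gt_zero)
  \<comment> \<open>Half of e goes to continuity at X and half to the Lipschitz step; B + 1 avoids a
    division by zero when B = 0.\<close>
  define \<eta> where "\<eta> = min \<delta> (e / (2 * (B + 1)))"
  have "\<eta> > 0" using \<delta> e B by (simp add: \<eta>_def)
  then obtain W where W: "W \<in> D" "frob (X - W) < \<eta>" using D(2) X by blast
  have WS: "W \<in> Sp p" using W D by auto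
  note carr = Sp_carrier[OF X] Sp_carrier[OF Y] Sp_carrier[OF WS]
  have comm: "frob (W - X) = frob (X - W)" using carr by (intro frob_minus_commute[of _ p])
  have "B * frob (W - Y) \<le> B * (frob (W - X) + frob (X - Y))"
    using carr B by (intro mult_left_mono frob_triangle[of _ p]) auto
  moreover have "B * frob (W - X) \<le> e / 2"
  proof -
    have "B * frob (W - X) \<le> (B + 1) * (e / (2 * (B + 1)))"
      using W(2) B comm by (intro mult_mono) (auto simp: \<eta>_def)
    also have "\<dots> = e / 2" using B by (simp add: field_simps)
    finally show ?thesis .
  qed
  moreover have "\<bar>Fn f n W zs - Fn f n X zs\<bar> \<le> e / 2"
    using W(2) comm by (intro \<delta>(2) WS) (simp add: \<eta>_def)
  ultimately show "Fn f n Y zs - Fn f n X zs \<le> B * frob (X - Y) + e"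
    using lip[OF W(1)] unfolding distrib_left abs_le_iff by linarith
qed

text \<open>\<open>T\<close> carries almost sure properties of the estimator into the event without
  any measurability of the map behind them. In the failure probability 6 = 4 + 2, from the nets and
  from the fixed matrix \<open>Xs\<close>; in the deviation 5y = 4y + y, the last y being the
  discretisation error.\<close>

lemma uniform_deviation:
  assumes T: "AE zs in P. T zs" and y1: "y \<le> 1" and Xs: "Xs \<in> Sp p" "sigma_max Xs \<le> R"
  shows "\<exists>A\<in>sets P. measure P A \<ge> 1 - exp (- (1/4) * real n) - 6 * exp (- c * (2 * real n * y\<^sup>2)) \<and>
    (\<forall>zs\<in>A. zs \<in> space P \<and> T zs \<and> Fn f n Xs zs \<le> EF \<mu> f Xs + 4 * K * y \<and>
      (\<forall>X\<in>Sp p. sigma_max X \<le> R \<longrightarrow> cont_at zs X \<longrightarrow>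
         EF \<mu> f X \<le> Fn f n X zs + K * (3/2 * (real (nz p X) * L * y\<^sup>2 / c) + 5 * y)))"
proof -
  obtain D where D: "countable D" "D \<subseteq> Sp p" "\<forall>X\<in>Sp p. \<forall>\<eta>>0. \<exists>Y\<in>D. frob (X - Y) < \<eta>"
    using Sp_separable[of p] by metis
  obtain N where N': "\<forall>k\<le>p. finite (N k) \<and> N k \<subseteq> {X \<in> Sp p. sigma_max X \<le> R} \<and>
      real (card (N k)) \<le> exp (2 * L) ^ (p * k)"
    "\<forall>X\<in>Sp p. sigma_max X \<le> R \<longrightarrow> (\<exists>Y\<in>N (nz p X). frob (X - Y) \<le> \<epsilon>)"
    using net by blast
  have N: "\<And>k. k \<le> p \<Longrightarrow> finite (N k)" "\<And>k. k \<le> p \<Longrightarrow> N k \<subseteq> {X \<in> Sp p. sigma_max X \<le> R}"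
    "\<And>k. k \<le> p \<Longrightarrow> real (card (N k)) \<le> exp (2 * L) ^ (p * k)"
    "\<And>X. X \<in> Sp p \<Longrightarrow> sigma_max X \<le> R \<Longrightarrow> \<exists>Y\<in>N (nz p X). frob (X - Y) \<le> \<epsilon>"
    using N' by auto
  define NN where "NN = (\<Union>k\<in>{..p}. N k)"
  have NN: "finite NN" "NN \<subseteq> Sp p" using N(1,2) by (auto simp: NN_def)
  have "AE zs in P. \<forall>W\<in>D. \<forall>Y\<in>NN. \<bar>Fn f n W zs - Fn f n Y zs\<bar> \<le> Cbar zs * frob (W - Y)"
    using D(1,2) NN countable_finite[OF NN(1)]
    by (intro AE_ball_countable[THEN iffD2] ballI AE_Fn_lipschitz) auto
  with T have "AE zs in P. T zs \<and> (\<forall>W\<in>D. \<forall>Y\<in>NN. \<bar>Fn f n W zs - Fn f n Y zs\<bar> \<le> Cbar zs * frob (W - Y))"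
    by eventually_elim simp
  \<comment> \<open>The exceptional set itself may fail to be measurable, so a null set covering it
    is removed.\<close>
  then have "\<exists>Z\<in>null_sets P. {zs \<in> space P. \<not> (T zs \<and>
      (\<forall>W\<in>D. \<forall>Y\<in>NN. \<bar>Fn f n W zs - Fn f n Y zs\<bar> \<le> Cbar zs * frob (W - Y)))} \<subseteq> Z"
    by (simp only: eventually_ae_filter)
  then obtain Z where Z: "Z \<in> null_sets P"
    "{zs \<in> space P. \<not> (T zs \<and> (\<forall>W\<in>D. \<forall>Y\<in>NN. \<bar>Fn f n W zs - Fn f n Y zs\<bar> \<le> Cbar zs * frob (W - Y)))} \<subseteq> Z"
    by blast
  define bad where "bad k X = {zs \<in> space P. \<bar>Fn f n X zs - EF \<mu> f X\<bar> > K * (sqrt (t k / real n) + t k / real n)}" for k X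
  define b1 where "b1 = {zs \<in> space P. Cbar zs > Cmu + 2 * KC}"
  define b2 where "b2 = (\<Union>k\<in>{..p}. \<Union>X\<in>N k. bad k X)"
  let ?q = "exp (- c * (2 * real n * y\<^sup>2))"
  have bad_sets: "bad k X \<in> sets P" if "X \<in> Sp p" for k X
  proof -
    have [measurable]: "(\<lambda>zs. Fn f n X zs) \<in> borel_measurable P" using Fn_measurable that by blast
    show ?thesis unfolding bad_def by measurable
  qed
  have b1: "b1 \<in> sets P" unfolding b1_def using Cbar_measurable by measurable
  have b2: "b2 \<in> sets P" unfolding b2_def
    using N(1,2) by (intro sets.finite_UN bad_sets) auto
  have bs: "bad 0 Xs \<in> sets P" using Xs by (intro bad_sets)
  have m1: "measure P b1 \<le> exp (- (1/4) * real n)" unfolding b1_def by (rule Cbar_tail)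
  have m2: "measure P b2 \<le> 4 * ?q" unfolding b2_def bad_def using N(1-3) by (rule net_failure)
  \<comment> \<open>\<open>t 0\<close> is 2 n y^2: a single fixed matrix carries no entropy
    term.\<close>
  have ms: "measure P (bad 0 Xs) \<le> 2 * ?q"
    using Fn_deviation[OF Xs t_nonneg[of 0]] by (simp add: bad_def t_def)
  have mZ: "measure P Z = 0" "Z \<in> sets P" using Z(1) by (auto simp: measure_def null_sets_def)
  define A where "A = space P - (b1 \<union> b2 \<union> bad 0 Xs \<union> Z)"
  have A: "A \<in> sets P" unfolding A_def using b1 b2 bs mZ by auto
  have "measure P (b1 \<union> b2 \<union> bad 0 Xs \<union> Z) \<le> measure P (b1 \<union> b2 \<union> bad 0 Xs) + measure P Z"
    using b1 b2 bs mZ by (intro measure_Un_le) auto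
  also have "measure P (b1 \<union> b2 \<union> bad 0 Xs) \<le> measure P (b1 \<union> b2) + measure P (bad 0 Xs)"
    using b1 b2 bs by (intro measure_Un_le) auto
  also have "measure P (b1 \<union> b2) \<le> measure P b1 + measure P b2"
    using b1 b2 by (intro measure_Un_le) auto
  finally have "measure P (b1 \<union> b2 \<union> bad 0 Xs \<union> Z) \<le> exp (- (1/4) * real n) + 6 * ?q"
    using m1 m2 ms mZ by simp
  moreover have "measure P A = 1 - measure P (b1 \<union> b2 \<union> bad 0 Xs \<union> Z)"
    unfolding A_def using b1 b2 bs mZ by (intro P.prob_compl) auto
  ultimately have mA: "measure P A \<ge> 1 - exp (- (1/4) * real n) - 6 * ?q" by simp
  have good: "zs \<in> space P \<and> T zs \<and> Fn f n Xs zs \<le> EF \<mu> f Xs + 4 * K * y \<and>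
      (\<forall>X\<in>Sp p. sigma_max X \<le> R \<longrightarrow> cont_at zs X \<longrightarrow>
         EF \<mu> f X \<le> Fn f n X zs + K * (3/2 * (real (nz p X) * L * y\<^sup>2 / c) + 5 * y))" if "zs \<in> A" for zs
  proof (intro conjI ballI impI)
    show sp: "zs \<in> space P" using that by (simp add: A_def)
    have Tz: "T zs \<and> (\<forall>W\<in>D. \<forall>Y\<in>NN. \<bar>Fn f n W zs - Fn f n Y zs\<bar> \<le> Cbar zs * frob (W - Y))"
      using that Z(2) by (auto simp: A_def)
    then show "T zs" by simp
    have Kd: "K * (sqrt (t k / real n) + t k / real n) \<le> K * (3/2 * (real k * L * y\<^sup>2 / c) + 4 * y)" for k
      using K by (intro mult_left_mono deviation_bound y1) auto
    have "\<bar>Fn f n Xs zs - EF \<mu> f Xs\<bar> \<le> K * (sqrt (t 0 / real n) + t 0 / real n)"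
      using that sp by (auto simp: A_def bad_def)
    then show "Fn f n Xs zs \<le> EF \<mu> f Xs + 4 * K * y" using Kd[of 0] by simp
    fix X assume X: "X \<in> Sp p" "sigma_max X \<le> R" and cont: "cont_at zs X"
    obtain Y where Y: "Y \<in> N (nz p X)" "frob (X - Y) \<le> \<epsilon>" using N(4)[OF X] by blast
    have YN: "Y \<in> NN" using Y(1) nz_le by (auto simp: NN_def)
    then have YS: "Y \<in> Sp p" using NN by auto
    have "zs \<notin> bad (nz p X) Y" using that Y(1) nz_le[of p X] by (auto simp: A_def b2_def)
    then have dev: "EF \<mu> f Y \<le> Fn f n Y zs + K * (3/2 * (real (nz p X) * L * y\<^sup>2 / c) + 4 * y)"
      using sp Kd[of "nz p X"] by (auto simp: bad_def)
    have Cb: "Cbar zs \<le> Cmu + 2 * KC" using that sp by (auto simp: A_def b1_def)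
    have "Fn f n Y zs - Fn f n X zs \<le> (Cmu + 2 * KC) * frob (X - Y)"
    proof (rule lipschitz_extends[OF D(2,3) X(1) YS cont])
      fix W assume "W \<in> D"
      then have "\<bar>Fn f n W zs - Fn f n Y zs\<bar> \<le> Cbar zs * frob (W - Y)" using Tz YN by blast
      also have "\<dots> \<le> (Cmu + 2 * KC) * frob (W - Y)" using Cb by (intro mult_right_mono) auto
      finally show "\<bar>Fn f n W zs - Fn f n Y zs\<bar> \<le> (Cmu + 2 * KC) * frob (W - Y)" .
    qed (use Cmu KC in auto)
    moreover have "EF \<mu> f X - EF \<mu> f Y \<le> Cmu * frob (X - Y)" by (rule EF_lipschitz[OF X(1) YS])
    moreover have "(2 * Cmu + 2 * KC) * frob (X - Y) \<le> (2 * Cmu + 2 * KC) * \<epsilon>"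
      using Y(2) Cmu KC by (intro mult_left_mono) auto
    ultimately show "EF \<mu> f X \<le> Fn f n X zs + K * (3/2 * (real (nz p X) * L * y\<^sup>2 / c) + 5 * y)"
      using dev lipschitz_eps by (simp add: algebra_simps)
  qed
  show ?thesis using A mA good by blast
qed

end

section \<open>Excess risk of S3ONC solutions\<close>

text \<open>A zero eigenvalue pays nothing and any other at most the plateau value. This bounds what
  the true minimiser pays.\<close>

lemma pen_le_rank:
  assumes "a > 0" "lam \<ge> 0" "X \<in> Sp p"
  shows "pen p a lam X \<le> real (mat_rank p X) * (a * lam\<^sup>2 / 2)"
proof -
  obtain d u where s: "spectral p X d u" and d: "\<And>j. j < p \<Longrightarrow> d j \<ge> 0"
    using Sp_spectral[OF assms(3)] by metis
  have "pen p a lam X = (\<Sum>j<p. mcp_form a lam (d j))" by (rule pen_spectral) fact+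
  also have "\<dots> \<le> (\<Sum>j<p. if d j \<noteq> 0 then a * lam\<^sup>2 / 2 else 0)"
  proof (rule sum_mono)
    fix j
    show "mcp_form a lam (d j) \<le> (if d j \<noteq> 0 then a * lam\<^sup>2 / 2 else 0)"
      using mcp_form_le[OF assms(1), of lam "d j"] assms by auto
  qed
  also have "\<dots> = real (card {j. j < p \<and> d j \<noteq> 0}) * (a * lam\<^sup>2 / 2)"
    by (simp add: sum.inter_filter[symmetric])
  also have "\<dots> \<le> real (mat_rank p X) * (a * lam\<^sup>2 / 2)"
    using card_nonzero_le_rank[OF s] assms by (intro mult_right_mono) auto
  finally show ?thesis .
qed

text \<open>Lets the nuclear-norm objective dominate the penalised one at its own minimiser.\<close>

lemma pen_le_nuc_norm:
  assumes "a > 0" "lam \<ge> 0" "X \<in> Sp p"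
  shows "pen p a lam X \<le> lam * nuc_norm X"
proof -
  obtain d u where s: "spectral p X d u" and d: "\<And>j. j < p \<Longrightarrow> d j \<ge> 0"
    using Sp_spectral[OF assms(3)] by metis
  have "pen p a lam X = (\<Sum>j<p. mcp_form a lam (d j))" by (rule pen_spectral) fact+
  also have "\<dots> \<le> (\<Sum>j<p. lam * d j)"
    using assms by (intro sum_mono mcp_form_le_linear)
  also have "\<dots> = lam * nuc_norm X"
    using nuc_norm_spectral[OF s] d by (simp add: sum_distrib_left)
  finally show ?thesis .
qed

lemma nuc_norm_le_rank:
  assumes "X \<in> Sp p" "sigma_max X \<le> R" "R \<ge> 0"
  shows "nuc_norm X \<le> real (mat_rank p X) * R"
proof -
  obtain d u where s: "spectral p X d u" and d: "\<And>j. j < p \<Longrightarrow> d j \<ge> 0"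
    using Sp_spectral[OF assms(1)] by metis
  have "nuc_norm X = (\<Sum>j<p. d j)" using d by (rule nuc_norm_spectral[OF s])
  also have "\<dots> \<le> (\<Sum>j<p. if d j \<noteq> 0 then R else 0)"
    using eigenvalue_le_sigma_max[OF s] assms(2) by (intro sum_mono) (force intro: order_trans)
  also have "\<dots> = real (card {j. j < p \<and> d j \<noteq> 0}) * R"
    by (simp add: sum.inter_filter[symmetric])
  also have "\<dots> \<le> real (mat_rank p X) * R"
    using card_nonzero_le_rank[OF s] assms by (intro mult_right_mono) auto
  finally show ?thesis .
qed

lemma Fnl_eq: "X \<in> Sp p \<Longrightarrow> Fnl f n a lam X zs = Fn f n X zs + pen p a lam X"
  using Sp_carrier[of X p] by (simp add: Fnl_def pen_def)

text \<open>For a = 1/(2 UL) the second-order condition reads UL - 2 UL \<ge> 0, so no eigenvalue lies in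
  the interval (0, a lam) and every nonzero eigenvalue pays the full penalty.\<close>
lemma S3ONC_pen:
  assumes UL: "UL > 0" and a: "a = 1 / (2 * UL)" and lam: "lam \<ge> 0" and X: "S3ONC p f n a lam UL zs X"
  shows "pen p a lam X = real (nz p X) * (a * lam\<^sup>2 / 2)"
proof -
  have a0: "a > 0" using UL a by simp
  have XS: "X \<in> Sp p" using X by (simp add: S3ONC_def)
  obtain d u where s: "spectral p X d u" and d: "\<And>j. j < p \<Longrightarrow> d j \<ge> 0"
    using Sp_spectral[OF XS] by metis
  have gap: "d j = 0 \<or> d j \<ge> a * lam" if j: "j < p" for j
  proof (rule ccontr)
    assume "\<not> (d j = 0 \<or> d j \<ge> a * lam)"
    then have dj: "0 < d j" "d j < a * lam" using d[OF j] by auto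
    obtain i where i: "i < p" "sigma X i = d j"
      using sigma_image[OF s] j by (metis imageE imageI lessThan_iff)
    have "UL + deriv (deriv (MCP a lam)) (d j) \<ge> 0"
      using X i dj by (auto simp: S3ONC_def)
    moreover have "deriv (deriv (MCP a lam)) (d j) = - 2 * UL"
      using deriv2_MCP[OF a0 dj] UL by (simp add: a)
    ultimately show False using UL by simp
  qed
  have "pen p a lam X = (\<Sum>j<p. mcp_form a lam (d j))" by (rule pen_spectral) fact+
  also have "\<dots> = (\<Sum>j<p. if d j \<noteq> 0 then a * lam\<^sup>2 / 2 else 0)"
  proof (rule sum.cong)
    fix j assume "j \<in> {..<p}"
    then show "mcp_form a lam (d j) = (if d j \<noteq> 0 then a * lam\<^sup>2 / 2 else 0)"
      using gap[of j] mcp_form_saturated[of a lam "d j"] a0 lam by auto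
  qed simp
  also have "\<dots> = real (nz p X) * (a * lam\<^sup>2 / 2)"
    unfolding nz_spectral[OF s] by (simp add: sum.inter_filter[symmetric])
  finally show ?thesis .
qed

context sample_problem
begin

text \<open>Stationarity makes the penalised objective continuous at X, and subtracting the
  Lipschitz penalty leaves the empirical risk continuous there. A zero gradient is more than enough,
  so the tolerance is simply taken to be 1.\<close>

lemma S3ONC_cont_at:
  assumes a: "a > 0" and lam: "lam \<ge> 0" and X: "S3ONC p f n a lam UL zs X"
  shows "cont_at zs X"
  unfolding cont_at_def
proof (intro allI impI)
  fix \<eta> :: real assume \<eta>: "\<eta> > 0"
  have XS: "X \<in> Sp p" and zg: "zero_grad_within (Sp p) (\<lambda>X. Fnl f n a lam X zs) X"
    using X by (auto simp: S3ONC_def)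
  have "(0::real) < 1" by simp
  from zg[unfolded zero_grad_within_def, THEN spec, THEN mp, OF this] obtain \<delta> where \<delta>: "\<delta> > 0" "\<forall>Y\<in>Sp p. frob (Y - X) < \<delta> \<longrightarrow>
      \<bar>Fnl f n a lam Y zs - Fnl f n a lam X zs\<bar> \<le> 1 * frob (Y - X)"
    by (elim exE conjE)
  define m where "m = 1 + lam * real p ^ 3"
  have m: "m > 0" using lam by (simp add: m_def add_pos_nonneg)
  show "\<exists>\<delta>>0. \<forall>Y\<in>Sp p. frob (Y - X) < \<delta> \<longrightarrow> \<bar>Fn f n Y zs - Fn f n X zs\<bar> \<le> \<eta>"
  proof (intro exI[of _ "min \<delta> (\<eta> / m)"] conjI ballI impI)
    show "min \<delta> (\<eta> / m) > 0" using \<delta> \<eta> m by simp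
    fix Y assume Y: "Y \<in> Sp p" "frob (Y - X) < min \<delta> (\<eta> / m)"
    have "\<bar>Fnl f n a lam Y zs - Fnl f n a lam X zs\<bar> \<le> frob (Y - X)" using \<delta> Y by simp
    moreover have "\<bar>pen p a lam Y - pen p a lam X\<bar> \<le> lam * real p ^ 3 * frob (Y - X)"
      using abs_pen_diff_le[OF a lam Y(1) XS] .
    ultimately have "\<bar>Fn f n Y zs - Fn f n X zs\<bar> \<le> frob (Y - X) + lam * real p ^ 3 * frob (Y - X)"
      unfolding Fnl_eq[OF XS] Fnl_eq[OF Y(1)] by linarith
    also have "\<dots> = frob (Y - X) * m" by (simp add: m_def algebra_simps)
    also have "\<dots> \<le> \<eta>" using Y(2) m by (simp add: pos_less_divide_eq less_imp_le)
    finally show "\<bar>Fn f n Y zs - Fn f n X zs\<bar> \<le> \<eta>" .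
  qed
qed

text \<open>\<open>B\<close> measures suboptimality against the unpenalised empirical risk at
  \<open>Xs\<close>, so one statement serves both starting points. The penalty 4Kx exceeds the
  rank-dependent deviation 3/2 Kx, and 9 = 5 + 4 collects the terms in y at the estimator and at
  \<open>Xs\<close>.\<close>

lemma excess_risk:
  assumes UL: "UL \<ge> 1" and a: "a = 1 / (2 * UL)"
    and lam: "lam = sqrt (8 * K * (2 * real p + 1) powr (2/3) / (c * a * real n powr (2/3)) * L)"
    and pn: "2 * real p + 1 \<le> real n"
    and Xs: "Xs \<in> Sp p" "sigma_max Xs \<le> R"
    and Xr: "\<And>zs. zs \<in> space P \<Longrightarrow> Xr zs \<in> Sp p \<and> sigma_max (Xr zs) \<le> R"
    and S3: "AE zs in P. S3ONC p f n a lam UL zs (Xr zs)"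
    and opt: "AE zs in P. Fnl f n a lam (Xr zs) zs \<le> Fn f n Xs zs + B"
  shows "\<exists>A\<in>sets P. measure P A \<ge> 1 - 2 * (real p + 1) * exp (- (1/4) * real n)
      - 6 * exp (- 2 * c * (2 * real p + 1) powr (2/3) * real n powr (1/3)) \<and>
    (\<forall>zs\<in>A. EF \<mu> f (Xr zs) - EF \<mu> f Xs \<le> B + 9 * K * y)"
proof -
  have a0: "a > 0" using UL a by simp
  have lam0: "lam \<ge> 0" using K a0 c L_ge by (simp add: lam)
  have "lam\<^sup>2 = 8 * K * (2 * real p + 1) powr (2/3) / (c * a * real n powr (2/3)) * L"
    unfolding lam using K a0 c L_ge by (intro real_sqrt_pow2) simp
  \<comment> \<open>The calibration of lam: one nonzero eigenvalue costs 4K times the contribution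
    of one unit of rank to x.\<close>
  then have lam2: "a * lam\<^sup>2 / 2 = 4 * K * L * y\<^sup>2 / c"
    using a0 by (simp add: y_square mult_ac)
  have y1: "y \<le> 1" using pn n powr_mono2[of "1/3" "(2 * real p + 1) / real n" 1] by (simp add: y_def)
  have "AE zs in P. S3ONC p f n a lam UL zs (Xr zs) \<and> Fnl f n a lam (Xr zs) zs \<le> Fn f n Xs zs + B"
    using S3 opt by eventually_elim simp
  from uniform_deviation[OF this y1 Xs]
  obtain A where A: "A \<in> sets P"
    "measure P A \<ge> 1 - exp (- (1/4) * real n) - 6 * exp (- c * (2 * real n * y\<^sup>2))"
    and good: "\<forall>zs\<in>A. zs \<in> space P \<and> (S3ONC p f n a lam UL zs (Xr zs) \<and> Fnl f n a lam (Xr zs) zs \<le> Fn f n Xs zs + B) \<and>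
      Fn f n Xs zs \<le> EF \<mu> f Xs + 4 * K * y \<and>
      (\<forall>X\<in>Sp p. sigma_max X \<le> R \<longrightarrow> cont_at zs X \<longrightarrow>
         EF \<mu> f X \<le> Fn f n X zs + K * (3/2 * (real (nz p X) * L * y\<^sup>2 / c) + 5 * y))"
    by blast
  have q: "- c * (2 * real n * y\<^sup>2) = - 2 * c * (2 * real p + 1) powr (2/3) * real n powr (1/3)"
    using n_y_square by (simp add: mult_ac)
  \<comment> \<open>The tail of the averaged Lipschitz constant enters once, and is enlarged to the
    stated prefactor 2(p+1).\<close>
  have "1 * exp (- (1/4) * real n) \<le> 2 * (real p + 1) * exp (- (1/4) * real n)"
    by (intro mult_right_mono) auto
  then have "measure P A \<ge> 1 - 2 * (real p + 1) * exp (- (1/4) * real n)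
      - 6 * exp (- 2 * c * (2 * real p + 1) powr (2/3) * real n powr (1/3))"
    using A(2) unfolding q by linarith
  moreover have "EF \<mu> f (Xr zs) - EF \<mu> f Xs \<le> B + 9 * K * y" if "zs \<in> A" for zs
  proof -
    let ?X = "Xr zs"
    define x where "x = real (nz p ?X) * L * y\<^sup>2 / c"
    have x: "x \<ge> 0" using L_ge c by (simp add: x_def)
    have S: "S3ONC p f n a lam UL zs ?X" and X: "?X \<in> Sp p" "sigma_max ?X \<le> R"
      and opt: "Fnl f n a lam ?X zs \<le> Fn f n Xs zs + B" and dev: "Fn f n Xs zs \<le> EF \<mu> f Xs + 4 * K * y"
      using good that Xr by auto
    have "EF \<mu> f ?X \<le> Fn f n ?X zs + K * (3/2 * x + 5 * y)"
      unfolding x_def using good that X S3ONC_cont_at[OF a0 lam0 S] by blast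
    moreover have "pen p a lam ?X = 4 * K * x"
      using S3ONC_pen[OF _ a lam0 S] UL unfolding lam2 by (simp add: x_def)
    moreover have "K * x \<ge> 0" using K x by simp
    ultimately show ?thesis
      using opt dev unfolding Fnl_eq[OF X(1)] by (simp add: algebra_simps)
  qed
  ultimately show ?thesis using A(1) by blast
qed

section \<open>Explicit rates for the two starting points\<close>

lemma y_le: "y \<le> 3 * (real p powr (1/3) / real n powr (1/3))"
proof -
  have "(2 * real p + 1) powr (1/3) \<le> (3 * real p) powr (1/3)" using p by (intro powr_mono2) auto
  also have "\<dots> = 3 powr (1/3) * real p powr (1/3)" by (simp add: powr_mult)
  also have "\<dots> \<le> 3 * real p powr (1/3)"
    using powr_mono[of "1/3" 1 "3::real"] by (intro mult_right_mono) auto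
  finally show ?thesis using n by (simp add: y_def powr_divide divide_right_mono)
qed

lemma y_square_le: "y\<^sup>2 \<le> 3 * (real p powr (2/3) / real n powr (2/3))"
proof -
  have "(2 * real p + 1) powr (2/3) \<le> (3 * real p) powr (2/3)" using p by (intro powr_mono2) auto
  also have "\<dots> = 3 powr (2/3) * real p powr (2/3)" by (simp add: powr_mult)
  also have "\<dots> \<le> 3 * real p powr (2/3)"
    using powr_mono[of "2/3" 1 "3::real"] by (intro mult_right_mono) auto
  finally show ?thesis using n by (simp add: y_square divide_right_mono)
qed

end

text \<open>Here B = \<Gamma> + s a lam^2/2. In C1, 12/c is the factor 4/c of the penalty times 3
  from \<open>y_square_le\<close>, and 27 is 9 times 3 from \<open>y_le\<close>. Parameters are
  given by equations so that the unfolded abbreviations match by \<open>refl\<close>.\<close>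

lemma near_optimal_bound:
  assumes a: "a = 1 / (2 * UL)"
    and L: "L = ln (real n powr (1/3) * real p) + ln (18 * R * (KC + Cmu))"
    and lam: "lam = sqrt (8 * K * (2 * real p + 1) powr (2/3) / (c * a * real n powr (2/3)) * L)"
    and C1: "C1 = 12 / c + 27" and c: "c > 0"
    and h: "p \<ge> 1" "n \<ge> 1" "UL \<ge> 1" "K \<ge> 1" "R \<ge> 1" "Cmu \<ge> 1" "KC \<ge> 1" and \<Gamma>: "\<Gamma> \<ge> 0"
    and set: "setting p q \<mu> f" and bern: "bernstein p n \<mu> f R K c"
    and Xs: "Xs \<in> Sp p" "sigma_max Xs \<le> R"
    and A4: "A4 p \<mu> f C Cmu KC"
    and Xr: "\<forall>zs\<in>space (sampleM n \<mu>). Xr zs \<in> Sp p \<and> sigma_max (Xr zs) \<le> R"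
    and S3: "AE zs in sampleM n \<mu>. S3ONC p f n a lam UL zs (Xr zs)"
    and n: "real n > C1 * ((\<Gamma> / K) ^ 3 + 1) * real p + C1 * real (mat_rank p Xs) * L"
    and opt: "AE zs in sampleM n \<mu>. Fnl f n a lam (Xr zs) zs \<le> Fnl f n a lam Xs zs + \<Gamma>"
  shows "\<exists>A\<in>sets (sampleM n \<mu>).
         measure (sampleM n \<mu>) A \<ge> 1 - 2 * (real p + 1) * exp (- (1/4) * real n)
                        - 6 * exp (- 2 * c * (2 * real p + 1) powr (2/3) * real n powr (1/3)) \<and>
         (\<forall>zs\<in>A. EF \<mu> f (Xr zs) - EF \<mu> f Xs \<le>
             sqrt (K * real p powr (1/3) * \<Gamma> / real n powr (1/3)) + \<Gamma>
             + C1 * K * (real (mat_rank p Xs) * real p powr (2/3) * L / real n powr (2/3)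
                         + sqrt (real (mat_rank p Xs) * L / real n)
                         + real p powr (1/3) / real n powr (1/3)))"
proof -
  have "prob_space \<mu>" and "\<And>X. X \<in> Sp p \<Longrightarrow> integrable \<mu> (f X)"
    using set unfolding setting_def by blast+
  interpret sp: sample_problem p n \<mu> f R K c C Cmu KC
    by (rule sample_problem.intro; fact)
  let ?s = "real (mat_rank p Xs)"
  have L': "L = sp.L" unfolding L sp.L_def ..
  have L1: "L \<ge> 1" using sp.L_ge L' by simp
  have a0: "a > 0" using h a by simp
  have lam0: "lam \<ge> 0" using h a0 c L1 by (simp add: lam)
  have C1': "C1 \<ge> 27" using c by (simp add: C1)
  \<comment> \<open>Only C1 \<ge> 27 is used: 27p \<ge> 2p+1 puts y below 1.\<close>
  have "27 * 1 * real p + 0 \<le> C1 * ((\<Gamma> / K) ^ 3 + 1) * real p + C1 * ?s * L"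
    using C1' \<Gamma> h L1 by (intro add_mono mult_mono) auto
  moreover have "real p \<ge> 1" using h by simp
  ultimately have pn: "2 * real p + 1 \<le> real n" using n by linarith
  define B where "B = \<Gamma> + ?s * (a * lam\<^sup>2 / 2)"
  have "AE zs in sampleM n \<mu>. Fnl f n a lam (Xr zs) zs \<le> Fn f n Xs zs + B"
    using opt
  proof eventually_elim
    case (elim zs)
    then show ?case
      using pen_le_rank[OF a0 lam0 Xs(1)] unfolding Fnl_eq[OF Xs(1)] B_def by linarith
  qed
  from sp.excess_risk[OF h(3) a lam[unfolded L'] pn Xs _ S3 this] Xr
  obtain A where A: "A \<in> sets (sampleM n \<mu>)"
    "measure (sampleM n \<mu>) A \<ge> 1 - 2 * (real p + 1) * exp (- (1/4) * real n)
      - 6 * exp (- 2 * c * (2 * real p + 1) powr (2/3) * real n powr (1/3))"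
    "\<forall>zs\<in>A. EF \<mu> f (Xr zs) - EF \<mu> f Xs \<le> B + 9 * K * sp.y" by blast
  have "lam\<^sup>2 = 8 * K * (2 * real p + 1) powr (2/3) / (c * a * real n powr (2/3)) * L"
    unfolding lam using h a0 c L1 by (intro real_sqrt_pow2) simp
  then have lam2: "a * lam\<^sup>2 / 2 = 4 * K * L / c * sp.y\<^sup>2"
    using a0 by (simp add: sp.y_square mult_ac)
  define X where "X = ?s * real p powr (2/3) * L / real n powr (2/3)"
  define Y where "Y = real p powr (1/3) / real n powr (1/3)"
  have XY: "X \<ge> 0" "Y \<ge> 0" using L1 by (auto simp: X_def Y_def)
  have "?s * (a * lam\<^sup>2 / 2) \<le> ?s * (4 * K * L / c * (3 * (real p powr (2/3) / real n powr (2/3))))"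
    unfolding lam2 using sp.y_square_le h c L1 by (intro mult_left_mono) auto
  also have "\<dots> = 12 / c * (K * X)" by (simp add: X_def)
  also have "\<dots> \<le> C1 * (K * X)" using XY h c by (intro mult_right_mono) (auto simp: C1)
  finally have 1: "?s * (a * lam\<^sup>2 / 2) \<le> C1 * (K * X)" .
  have "9 * K * sp.y \<le> 9 * K * (3 * Y)"
    unfolding Y_def using sp.y_le h by (intro mult_left_mono) auto
  also have "\<dots> = 27 * (K * Y)" by simp
  also have "\<dots> \<le> C1 * (K * Y)" using XY h C1' by (intro mult_right_mono) auto
  finally have 2: "9 * K * sp.y \<le> C1 * (K * Y)" .
  have 3: "0 \<le> C1 * (K * sqrt (?s * L / real n))" using C1' h L1 by simp
  have 4: "0 \<le> sqrt (K * real p powr (1/3) * \<Gamma> / real n powr (1/3))" using h \<Gamma> by simp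
  have "B + 9 * K * sp.y \<le> sqrt (K * real p powr (1/3) * \<Gamma> / real n powr (1/3)) + \<Gamma>
      + C1 * K * (X + sqrt (?s * L / real n) + Y)"
    using 1 2 3 4 unfolding B_def mult.assoc distrib_left by linarith
  then show ?thesis using A unfolding X_def Y_def by (intro bexI[of _ A]) force+
qed

text \<open>The penalised objective at the nuclear-norm solution is at most its nuclear-norm
  objective, hence at most that of \<open>Xs\<close>; so B = lam s R. In C2, 12 / sqrt c is the 4 /
  sqrt c in the bound for lam times 3 from \<open>y_le\<close>.\<close>

lemma nuclear_start_bound:
  assumes a: "a = 1 / (2 * UL)"
    and L: "L = ln (real n powr (1/3) * real p) + ln (18 * R * (KC + Cmu))"
    and lam: "lam = sqrt (8 * K * (2 * real p + 1) powr (2/3) / (c * a * real n powr (2/3)) * L)"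
    and C2: "C2 = 12 / sqrt c + 27" and c: "c > 0"
    and h: "p \<ge> 1" "n \<ge> 1" "UL \<ge> 1" "K \<ge> 1" "R \<ge> 1" "Cmu \<ge> 1" "KC \<ge> 1"
    and set: "setting p q \<mu> f" and bern: "bernstein p n \<mu> f R K c"
    and Xs: "Xs \<in> Sp p" "sigma_max Xs \<le> R" and s: "1 \<le> mat_rank p Xs"
    and A4: "A4 p \<mu> f C Cmu KC"
    and Xl1: "\<forall>zs\<in>space (sampleM n \<mu>). Xl1 zs \<in> Sp p \<and>
          (\<forall>X\<in>Sp p. Fn f n (Xl1 zs) zs + lam * nuc_norm (Xl1 zs) \<le> Fn f n X zs + lam * nuc_norm X)"
    and Xr: "\<forall>zs\<in>space (sampleM n \<mu>). Xr zs \<in> Sp p \<and> sigma_max (Xr zs) \<le> R"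
    and S3: "AE zs in sampleM n \<mu>. S3ONC p f n a lam UL zs (Xr zs)"
    and n: "real n > C2 * real p * UL * L * real (mat_rank p Xs) powr (3/2) * R powr (3/2)"
    and opt: "AE zs in sampleM n \<mu>. Fnl f n a lam (Xr zs) zs \<le> Fnl f n a lam (Xl1 zs) zs"
  shows "\<exists>A\<in>sets (sampleM n \<mu>).
         measure (sampleM n \<mu>) A \<ge> 1 - 2 * (real p + 1) * exp (- (1/4) * real n)
                        - 6 * exp (- 2 * c * (2 * real p + 1) powr (2/3) * real n powr (1/3)) \<and>
         (\<forall>zs\<in>A. EF \<mu> f (Xr zs) - EF \<mu> f Xs \<le>
             C2 * real (mat_rank p Xs) * K * (real p powr (2/3) * L / real n powr (2/3)
                 + real p powr (1/3) * R * sqrt UL * sqrt L / real n powr (1/3)))"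
proof -
  have "prob_space \<mu>" and "\<And>X. X \<in> Sp p \<Longrightarrow> integrable \<mu> (f X)"
    using set unfolding setting_def by blast+
  interpret sp: sample_problem p n \<mu> f R K c C Cmu KC
    by (rule sample_problem.intro; fact)
  let ?s = "real (mat_rank p Xs)"
  have s1: "?s \<ge> 1" using s by simp
  have L': "L = sp.L" unfolding L sp.L_def ..
  have L1: "L \<ge> 1" using sp.L_ge L' by simp
  have a0: "a > 0" using h a by simp
  have lam0: "lam \<ge> 0" using h a0 c L1 by (simp add: lam)
  have C2': "C2 \<ge> 27" using c by (simp add: C2)
  have "27 * real p * 1 * 1 * 1 * 1 \<le> C2 * real p * UL * L * ?s powr (3/2) * R powr (3/2)"
    using C2' h L1 s1 by (intro mult_mono ge_one_powr_ge_zero) auto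
  moreover have "real p \<ge> 1" using h by simp
  ultimately have pn: "2 * real p + 1 \<le> real n" using n by linarith
  define B where "B = lam * (?s * R)"
  have "AE zs in sampleM n \<mu>. Fnl f n a lam (Xr zs) zs \<le> Fn f n Xs zs + B"
    using opt AE_space
  proof eventually_elim
    case (elim zs)
    have l: "Xl1 zs \<in> Sp p" "Fn f n (Xl1 zs) zs + lam * nuc_norm (Xl1 zs) \<le> Fn f n Xs zs + lam * nuc_norm Xs"
      using Xl1 elim(2) Xs by auto
    have "lam * nuc_norm Xs \<le> B"
      unfolding B_def using nuc_norm_le_rank[OF Xs] h lam0 by (intro mult_left_mono) auto
    then show ?case
      using elim(1) l(2) pen_le_nuc_norm[OF a0 lam0 l(1)] unfolding Fnl_eq[OF l(1)] by linarith
  qed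
  from sp.excess_risk[OF h(3) a lam[unfolded L'] pn Xs _ S3 this] Xr
  obtain A where A: "A \<in> sets (sampleM n \<mu>)"
    "measure (sampleM n \<mu>) A \<ge> 1 - 2 * (real p + 1) * exp (- (1/4) * real n)
      - 6 * exp (- 2 * c * (2 * real p + 1) powr (2/3) * real n powr (1/3))"
    "\<forall>zs\<in>A. EF \<mu> f (Xr zs) - EF \<mu> f Xs \<le> B + 9 * K * sp.y" by blast
  \<comment> \<open>16 = 8 times 2, because 1/a = 2 UL.\<close>
  have "lam = sqrt (16 * K * UL * L * sp.y\<^sup>2 / c)"
    using h c by (simp add: lam a sp.y_square field_simps)
  also have "\<dots> = 4 * sqrt K * sqrt UL * sqrt L * sp.y / sqrt c"
    using sp.y_pos by (simp add: real_sqrt_mult real_sqrt_divide)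
  also have "\<dots> \<le> 4 * K * sqrt UL * sqrt L * sp.y / sqrt c"
  proof -
    have "sqrt K \<le> K" using h sqrt_le_D[of K K] by (intro real_le_lsqrt) (auto simp: power2_eq_square)
    then show ?thesis using h L1 sp.y_pos c by (intro divide_right_mono mult_right_mono mult_left_mono) auto
  qed
  finally have lam_le: "lam \<le> 4 * K * sqrt UL * sqrt L * sp.y / sqrt c" .
  define W where "W = K * (real p powr (1/3) * R * sqrt UL * sqrt L / real n powr (1/3))"
  have W: "W \<ge> 0" using h L1 by (simp add: W_def)
  have "B \<le> (4 * K * sqrt UL * sqrt L * (3 * (real p powr (1/3) / real n powr (1/3))) / sqrt c) * (?s * R)"
    unfolding B_def using lam_le sp.y_le h L1 c s1
    by (intro mult_right_mono order_trans[OF lam_le] divide_right_mono mult_left_mono) auto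
  also have "\<dots> = 12 / sqrt c * (?s * W)" by (simp add: W_def mult_ac)
  finally have 1: "B \<le> 12 / sqrt c * (?s * W)" .
  have "9 * K * sp.y \<le> 9 * K * (3 * (real p powr (1/3) / real n powr (1/3)))"
    using sp.y_le h by (intro mult_left_mono) auto
  \<comment> \<open>The factors 1 are placeholders, replaced in the next step by s, R, sqrt UL and
    sqrt L, all at least 1; so the term in y joins the second summand.\<close>
  also have "\<dots> = 1 * (27 * (K * (real p powr (1/3) * 1 * 1 * 1 / real n powr (1/3))))" by simp
  also have "\<dots> \<le> ?s * (27 * W)"
    unfolding W_def using s1 h L1 by (intro mult_mono divide_right_mono) auto
  finally have 2: "9 * K * sp.y \<le> 27 * (?s * W)" by simp
  have 3: "0 \<le> C2 * ?s * K * (real p powr (2/3) * L / real n powr (2/3))"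
    using C2' h L1 by simp
  have "B + 9 * K * sp.y \<le> C2 * (?s * W)" using 1 2 by (simp add: C2 algebra_simps)
  also have "\<dots> \<le> C2 * ?s * K * (real p powr (2/3) * L / real n powr (2/3)
                 + real p powr (1/3) * R * sqrt UL * sqrt L / real n powr (1/3))"
    using 3 by (simp add: W_def algebra_simps)
  finally show ?thesis using A by (intro bexI[of _ A]) force+
qed

text \<open>Both constants are chosen before all problem data and depend on the Bernstein constant c
  alone. The probability statement is phrased through a measurable event because the estimator is an
  arbitrary map of the sample.\<close>

theorem theorem3:
  fixes c :: real
  assumes "0 < c" and "c \<le> 1/2"
  shows
  "(\<exists>ct C1. ct > 0 \<and> C1 > 0 \<and>
     (\<forall>(p::nat) (n::nat) (q::nat) (\<mu> :: (nat \<Rightarrow> real) measure)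
        (f :: real mat \<Rightarrow> (nat \<Rightarrow> real) \<Rightarrow> real) (UL::real) (K::real) (R::real)
        (C :: (nat \<Rightarrow> real) \<Rightarrow> real) (Cmu::real) (KC::real) (Xs :: real mat)
        (Xr :: (nat \<Rightarrow> nat \<Rightarrow> real) \<Rightarrow> real mat) (\<Gamma>::real).
      let a = 1 / (2 * UL);
          \<Delta> = ln (18 * R * (KC + Cmu));
          L = ln (real n powr (1/3) * real p) + \<Delta>;
          lam = sqrt (8 * K * (2 * real p + 1) powr (2/3) / (c * a * real n powr (2/3)) * L);
          s = mat_rank p Xs;
          P = sampleM n \<mu>
      in
      p \<ge> 1 \<and> n \<ge> 1 \<and> UL \<ge> 1 \<and> K \<ge> 1 \<and> R \<ge> 1 \<and> Cmu \<ge> 1 \<and> KC \<ge> 1 \<and> \<Gamma> \<ge> 0 \<and>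
      setting p q \<mu> f \<and> bernstein p n \<mu> f R K c \<and>
      Xs \<in> Sp p \<and> (\<forall>X\<in>Sp p. EF \<mu> f Xs \<le> EF \<mu> f X) \<and> sigma_max Xs \<le> R \<and>
      1 \<le> s \<and> A2 p \<mu> f UL \<and> A3 p \<mu> f R K \<and> A4 p \<mu> f C Cmu KC \<and>
      (\<forall>zs\<in>space P. Xr zs \<in> Sp p \<and> sigma_max (Xr zs) \<le> R) \<and>
      (AE zs in P. S3ONC p f n a lam UL zs (Xr zs)) \<and>
      real n > C1 * ((\<Gamma> / K) ^ 3 + 1) * real p + C1 * real s * L \<and>
      (AE zs in P. Fnl f n a lam (Xr zs) zs \<le> Fnl f n a lam Xs zs + \<Gamma>)
      \<longrightarrow>
      (\<exists>A\<in>sets P.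
         measure P A \<ge> 1 - 2 * (real p + 1) * exp (- ct * real n)
                        - 6 * exp (- 2 * c * (2 * real p + 1) powr (2/3) * real n powr (1/3)) \<and>
         (\<forall>zs\<in>A. EF \<mu> f (Xr zs) - EF \<mu> f Xs \<le>
             sqrt (K * real p powr (1/3) * \<Gamma> / real n powr (1/3)) + \<Gamma>
             + C1 * K * (real s * real p powr (2/3) * L / real n powr (2/3)
                         + sqrt (real s * L / real n)
                         + real p powr (1/3) / real n powr (1/3))))))
   \<and>
   (\<exists>ct C2. ct > 0 \<and> C2 > 0 \<and>
     (\<forall>(p::nat) (n::nat) (q::nat) (\<mu> :: (nat \<Rightarrow> real) measure)
        (f :: real mat \<Rightarrow> (nat \<Rightarrow> real) \<Rightarrow> real) (UL::real) (K::real) (R::real)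
        (C :: (nat \<Rightarrow> real) \<Rightarrow> real) (Cmu::real) (KC::real) (Xs :: real mat)
        (Xr :: (nat \<Rightarrow> nat \<Rightarrow> real) \<Rightarrow> real mat) (Xl1 :: (nat \<Rightarrow> nat \<Rightarrow> real) \<Rightarrow> real mat).
      let a = 1 / (2 * UL);
          \<Delta> = ln (18 * R * (KC + Cmu));
          L = ln (real n powr (1/3) * real p) + \<Delta>;
          lam = sqrt (8 * K * (2 * real p + 1) powr (2/3) / (c * a * real n powr (2/3)) * L);
          s = mat_rank p Xs;
          P = sampleM n \<mu>
      in
      p \<ge> 1 \<and> n \<ge> 1 \<and> UL \<ge> 1 \<and> K \<ge> 1 \<and> R \<ge> 1 \<and> Cmu \<ge> 1 \<and> KC \<ge> 1 \<and>
      setting p q \<mu> f \<and> bernstein p n \<mu> f R K c \<and>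
      Xs \<in> Sp p \<and> (\<forall>X\<in>Sp p. EF \<mu> f Xs \<le> EF \<mu> f X) \<and> sigma_max Xs \<le> R \<and>
      1 \<le> s \<and> A2 p \<mu> f UL \<and> A3 p \<mu> f R K \<and> A4 p \<mu> f C Cmu KC \<and>
      (\<forall>zs\<in>space P. Xl1 zs \<in> Sp p \<and>
          (\<forall>X\<in>Sp p. Fn f n (Xl1 zs) zs + lam * nuc_norm (Xl1 zs) \<le> Fn f n X zs + lam * nuc_norm X)) \<and>
      (\<forall>zs\<in>space P. Xr zs \<in> Sp p \<and> sigma_max (Xr zs) \<le> R) \<and>
      (AE zs in P. S3ONC p f n a lam UL zs (Xr zs)) \<and>
      real n > C2 * real p * UL * L * real s powr (3/2) * R powr (3/2) \<and>
      (AE zs in P. Fnl f n a lam (Xr zs) zs \<le> Fnl f n a lam (Xl1 zs) zs)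
      \<longrightarrow>
      (\<exists>A\<in>sets P.
         measure P A \<ge> 1 - 2 * (real p + 1) * exp (- ct * real n)
                        - 6 * exp (- 2 * c * (2 * real p + 1) powr (2/3) * real n powr (1/3)) \<and>
         (\<forall>zs\<in>A. EF \<mu> f (Xr zs) - EF \<mu> f Xs \<le>
             C2 * real s * K * (real p powr (2/3) * L / real n powr (2/3)
                 + real p powr (1/3) * R * sqrt UL * sqrt L / real n powr (1/3))))))"
  unfolding Let_def
  apply (rule conjI)
   apply (rule exI[of _ "1/4"], rule exI[of _ "12 / c + 27"])
   apply (intro conjI allI impI)
     apply simp
  using assms apply (simp add: add_pos_pos)
   apply (elim conjE)
   apply (rule near_optimal_bound[OF refl refl refl refl]; (rule assms | assumption))
  apply (rule exI[of _ "1/4"], rule exI[of _ "12 / sqrt c + 27"])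
  apply (intro conjI allI impI)
    apply simp
  using assms apply (simp add: add_pos_pos)
  apply (elim conjE)
  apply (rule nuclear_start_bound[OF refl refl refl refl]; (rule assms | assumption))
  done

end
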